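(* Let $N\ge1$ and $p\in(1,3+\frac4N)$. For $c>0$ such that $J$ has a global minimum on $S(c)$, let $v_c$ be a global minimum of $J$ on $S(c)$ and let $\beta_c<0$ be its Lagrange multiplier. Then $\beta_c\to-\infty$ as $c\to\infty$.
   Context: Functions are real-valued on $\mathbb R^N$. Let $\mathcal X=\{u\in W^{1,2}(\mathbb R^N):\int_{\mathbb R^N}|u|^2|\nabla u|^2dx<\infty\}$, and for $c>0$ let $S(c)=\{u\in\mathcal X:\int_{\mathbb R^N}|u|^2dx=c\}$. Define $$J(u)=\frac12\int_{\mathbb R^N}|\nabla u|^2dx+\int_{\mathbb R^N}|u|^2|\nabla u|^2dx-\frac1{p+1}\int_{\mathbb R^N}|u|^{p+1}dx.$$ A global minimum of $J$ on $S(c)$ is a $v_c\in S(c)$ with $J(v_c)=m(c):=\inf_{u\in S(c)}J(u)$. It is known that to each such minimizer corresponds a Lagrange multiplier $\beta_c<0$, i.e. $v_c$ is a weak solution of $(P_\lambda)$: $-\Delta u-u\Delta(|u|^2)-\lambda u-|u|^{p-1}u=0$ in $\mathbb R^N$, with $\lambda=\beta_c$. Here a weak solution of $(P_\lambda)$ is a $u\in\mathcal X$ such that for all $\phi\in C_0^\infty(\mathbb R^N,\mathbb R)$, $$\int\nabla u\cdot\nabla\phi\,dx+2\int\big(u\phi|\nabla u|^2+|u|^2\nabla u\cdot\nabla\phi\big)dx-\lambda\int u\phi\,dx-\int|u|^{p-1}u\phi\,dx=0.$$ *)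

theory Defs
  imports "HOL-Analysis.Analysis"
begin

primrec Ck :: "nat \<Rightarrow> ('a::euclidean_space \<Rightarrow> real) \<Rightarrow> bool" where
  "Ck 0 f \<longleftrightarrow> continuous_on UNIV f"
| "Ck (Suc k) f \<longleftrightarrow> f differentiable_on UNIV \<and>
     (\<forall>b\<in>Basis. Ck k (\<lambda>x. frechet_derivative f (at x) b))"

definition test_function :: "('a::euclidean_space \<Rightarrow> real) \<Rightarrow> bool" where
  "test_function \<phi> \<longleftrightarrow> (\<forall>k. Ck k \<phi>) \<and> compact (closure {x. \<phi> x \<noteq> 0})"

definition grad :: "('a::euclidean_space \<Rightarrow> real) \<Rightarrow> 'a \<Rightarrow> 'a" where
  "grad f x = (\<Sum>b\<in>Basis. frechet_derivative f (at x) b *\<^sub>R b)"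

definition locally_integrable :: "('a::euclidean_space \<Rightarrow> 'b::euclidean_space) \<Rightarrow> bool" where
  "locally_integrable f \<longleftrightarrow> f \<in> borel_measurable lebesgue \<and>
     (\<forall>K. compact K \<longrightarrow> set_integrable lebesgue K f)"

text \<open>The integration by parts formula is stated for all partial derivatives at once,
  as an equation between vector-valued integrals.\<close>

definition has_weak_grad :: "('a::euclidean_space \<Rightarrow> real) \<Rightarrow> ('a \<Rightarrow> 'a) \<Rightarrow> bool" where
  "has_weak_grad u g \<longleftrightarrow> locally_integrable u \<and> locally_integrable g \<and>
     (\<forall>\<phi>. test_function \<phi> \<longrightarrow>
        (LINT x|lebesgue. u x *\<^sub>R grad \<phi> x) = - (LINT x|lebesgue. \<phi> x *\<^sub>R g x))"

text \<open>The weak gradient is unique only up to null sets; below it occurs only in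
  Lebesgue integrals and integrability conditions, which do not depend on the choice.\<close>

definition weak_grad :: "('a::euclidean_space \<Rightarrow> real) \<Rightarrow> 'a \<Rightarrow> 'a" where
  "weak_grad u = (SOME g. has_weak_grad u g)"

text \<open>Functions stand for their classes modulo equality almost everywhere.\<close>

definition W12 :: "('a::euclidean_space \<Rightarrow> real) set" where
  "W12 = {u. u \<in> borel_measurable lebesgue \<and> integrable lebesgue (\<lambda>x. \<bar>u x\<bar>\<^sup>2) \<and>
     (\<exists>g. has_weak_grad u g \<and> integrable lebesgue (\<lambda>x. (norm (g x))\<^sup>2))}"

definition X_space :: "('a::euclidean_space \<Rightarrow> real) set" where
  "X_space = {u \<in> W12. integrable lebesgue (\<lambda>x. \<bar>u x\<bar>\<^sup>2 * (norm (weak_grad u x))\<^sup>2)}"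

definition S :: "real \<Rightarrow> ('a::euclidean_space \<Rightarrow> real) set" where
  "S c = {u \<in> X_space. (LINT x|lebesgue. \<bar>u x\<bar>\<^sup>2) = c}"

text \<open>For \<open>1 < p < 3 + 4/N\<close> the three integrals are finite on the space above (the last one
  by the Gagliardo-Nirenberg inequality applied to \<open>u\<^sup>2\<close>), so \<open>J\<close> is real-valued and the
  value \<open>0\<close> of a Bochner integral of a non-integrable function plays no role.\<close>

definition J :: "real \<Rightarrow> ('a::euclidean_space \<Rightarrow> real) \<Rightarrow> real" where
  "J p u = 1/2 * (LINT x|lebesgue. (norm (weak_grad u x))\<^sup>2)
     + (LINT x|lebesgue. \<bar>u x\<bar>\<^sup>2 * (norm (weak_grad u x))\<^sup>2)
     - 1/(p+1) * (LINT x|lebesgue. \<bar>u x\<bar> powr (p+1))"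

text \<open>The infimum is taken in the extended reals, since \<open>Inf\<close> on \<open>real\<close> is unspecified
  for sets that are empty or unbounded below. The \<open>itself\<close> argument fixes the domain.\<close>

definition m :: "'a::euclidean_space itself \<Rightarrow> real \<Rightarrow> real \<Rightarrow> ereal" where
  "m _ p c = (INF u\<in>(S c :: ('a \<Rightarrow> real) set). ereal (J p u))"

definition global_min :: "real \<Rightarrow> real \<Rightarrow> ('a::euclidean_space \<Rightarrow> real) \<Rightarrow> bool" where
  "global_min p c v \<longleftrightarrow> v \<in> S c \<and> ereal (J p v) = m TYPE('a) p c"

definition weak_solution :: "real \<Rightarrow> real \<Rightarrow> ('a::euclidean_space \<Rightarrow> real) \<Rightarrow> bool" where
  "weak_solution p l u \<longleftrightarrow> u \<in> X_space \<and>
     (\<forall>\<phi>. test_function \<phi> \<longrightarrow>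
        (LINT x|lebesgue. weak_grad u x \<bullet> grad \<phi> x)
        + 2 * (LINT x|lebesgue. u x * \<phi> x * (norm (weak_grad u x))\<^sup>2
                               + \<bar>u x\<bar>\<^sup>2 * (weak_grad u x \<bullet> grad \<phi> x))
        - l * (LINT x|lebesgue. u x * \<phi> x)
        - (LINT x|lebesgue. \<bar>u x\<bar> powr (p-1) * u x * \<phi> x) = 0)"

end

theory Submission
  imports Defs "HOL-Computational_Algebra.Polynomial"
begin

text \<open>
  Let \<open>v\<close> minimize \<open>J\<close> on \<open>S c\<close> and put \<open>G(v) = 1/2 \<integral>|\<nabla>v|\<^sup>2 + \<integral>|v|\<^sup>2|\<nabla>v|\<^sup>2\<close>. The weak equation cannot be
  tested with \<open>v\<close> itself without regularity theory. Instead, take a test function \<open>\<phi>\<close> with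
  \<open>\<integral>v \<phi> \<noteq> 0\<close> and dilate \<open>v + t \<phi>\<close> back to mass \<open>c\<close>. By minimality the derivative of the energy along this
  curve vanishes at \<open>t = 0\<close>; the variation in direction \<open>\<phi>\<close> is \<open>\<beta> \<integral>v \<phi>\<close> by the weak equation, and the
  variation from the dilation is explicit. This gives \<open>\<beta> c = 2 J(v) - (4/N) G(v) \<le> 2 m(c)\<close>.
  The power term is only bounded below by its tangent, since it is convex in \<open>t\<close>. Finally
  \<open>m(c) / c \<rightarrow> -\<infinity>\<close>, by comparison with amplified and dilated bump functions.
\<close>

subsection \<open>Smooth bump functions\<close>

text \<open>The obstacle to testing with \<open>v\<close> is the quasilinear term: approximation of
  \<open>v\<close> by test functions in W^{1,2} does not control integrals with the weights
  \<open>v |\<nabla>v|^2\<close> and \<open>v^2\<close>. Varying in one fixed smooth direction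
  avoids this limit, and the multiplier is then read off after division by
  \<open>\<integral>v \<phi>\<close>. Dilation, rather than multiplication by a constant, restores
  the mass because all terms of \<open>J\<close> then share the factor \<open>r^N\<close>.
  Differentiating this factor reproduces \<open>J\<close> itself, and only the gradient terms carry
  an additional \<open>r^(-2)\<close>. Their contribution \<open>-(4/N) G\<close> has a sign, so the
  bound by \<open>2 m(c)\<close> follows without knowing how the energy splits into its parts; a
  constant factor would weight the quadratic, quartic and power terms differently. A one-sided bound
  for the power term suffices because this term enters \<open>J\<close> with a minus sign: the
  tangent gives a differentiable function of \<open>t\<close> that lies above the energy of the
  competitors and touches it at \<open>t = 0\<close>. Both signs of \<open>t\<close> are admissible,
  so its derivative there is zero.\<close>

lemma Ck_SucD: "Ck (Suc k) f \<Longrightarrow> Ck k f"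
  by (induction k arbitrary: f) (auto simp: differentiable_imp_continuous_on)

text \<open>Uniqueness of the Frechet derivative allows smoothness to be checked on any explicit
  derivative. The inductive closure rules below all go through this rule.\<close>

lemma Ck_SucI:
  assumes "\<And>x. (f has_derivative D x) (at x)" and "\<And>b. b \<in> Basis \<Longrightarrow> Ck k (\<lambda>x. D x b)"
  shows "Ck (Suc k) f"
proof -
  have "frechet_derivative f (at x) = D x" for x
    using frechet_derivative_at[OF assms(1)] by simp
  then show ?thesis
    using assms by (auto simp: differentiable_on_def differentiable_def)
qed

lemma Ck_Suc_has_derivative:
  "Ck (Suc k) f \<Longrightarrow> (f has_derivative frechet_derivative f (at x)) (at x)"
  by (auto simp: differentiable_on_def frechet_derivative_works)

lemma Ck_const: "Ck k (\<lambda>x. c)"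
proof (induction k arbitrary: c)
  case (Suc k)
  show ?case by (rule Ck_SucI[where D = "\<lambda>_ _. 0"]) (auto intro: Suc)
qed auto

lemma Ck_add:
  assumes "Ck k f" and "Ck k g" shows "Ck k (\<lambda>x. f x + g x)"
  using assms
proof (induction k arbitrary: f g)
  case 0
  then show ?case by (auto intro: continuous_on_add)
next
  case (Suc k)
  show ?case
    by (rule Ck_SucI[OF has_derivative_add[OF Ck_Suc_has_derivative[OF Suc.prems(1)]
          Ck_Suc_has_derivative[OF Suc.prems(2)]]]) (use Suc in auto)
qed

lemma Ck_mult:
  assumes "Ck k f" and "Ck k g" shows "Ck k (\<lambda>x. f x * g x)"
  using assms
proof (induction k arbitrary: f g)
  case 0
  then show ?case by (auto intro: continuous_on_mult)
next
  case (Suc k)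
  \<comment> \<open>The product rule leaves undifferentiated factors, so their order is lowered to
    \<open>k\<close> to meet the induction hypothesis.\<close>
  have "Ck k f" "Ck k g"
    using Suc.prems Ck_SucD by auto
  then show ?case
    by (intro Ck_SucI[OF has_derivative_mult[OF Ck_Suc_has_derivative[OF Suc.prems(1)]
          Ck_Suc_has_derivative[OF Suc.prems(2)]]] Ck_add Suc.IH) (use Suc in auto)
qed

lemma Ck_prod: "finite I \<Longrightarrow> (\<And>i. i \<in> I \<Longrightarrow> Ck k (f i)) \<Longrightarrow> Ck k (\<lambda>x. \<Prod>i\<in>I. f i x)"
  by (induction rule: finite_induct) (auto intro: Ck_const Ck_mult)

lemma Ck_scale:
  assumes "Ck k f" shows "Ck k (\<lambda>x. f (r *\<^sub>R x))"
  using assms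
proof (induction k arbitrary: f)
  case 0
  then have "continuous_on UNIV f" by simp
  then have "continuous_on UNIV (f \<circ> (*\<^sub>R) r)"
    by (intro continuous_on_compose continuous_intros) (auto intro: continuous_on_subset)
  then show ?case by (simp add: o_def)
next
  case (Suc k)
  have d: "((\<lambda>x. f (r *\<^sub>R x)) has_derivative (\<lambda>y. frechet_derivative f (at (r *\<^sub>R x)) (r *\<^sub>R y))) (at x)"
    for x
    by (rule has_derivative_compose[OF _ Ck_Suc_has_derivative[OF Suc.prems]])
      (auto intro!: derivative_eq_intros)
  have "frechet_derivative f (at (r *\<^sub>R x)) (r *\<^sub>R b) = r * frechet_derivative f (at (r *\<^sub>R x)) b" for x b
    using linear_frechet_derivative[of f "at (r *\<^sub>R x)"] Suc.prems
    by (simp add: linear_cmul differentiable_on_def)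
  then show ?case
    using Suc by (intro Ck_SucI[OF d]) (auto intro!: Ck_mult Ck_const)
qed

text \<open>Differentiating a function of \<open>\<alpha> + x \<bullet> w\<close> in a basis
  direction gives a constant times a function of the same shape. In a family closed under
  derivatives the induction on \<open>k\<close> can therefore run over all members at once, without
  formulas for higher derivatives.\<close>

lemma Ck_ridge:
  fixes F :: "(real \<Rightarrow> real) set" and w :: "'a::euclidean_space"
  assumes "\<And>h. h \<in> F \<Longrightarrow> \<exists>h'\<in>F. \<forall>s. (h has_real_derivative h' s) (at s)" and "h \<in> F"
  shows "Ck k (\<lambda>x. h (\<alpha> + x \<bullet> w))"
  using \<open>h \<in> F\<close>
proof (induction k arbitrary: h)
  case 0
  from assms(1)[OF 0] have "\<And>s. isCont h s"
    by (auto intro: DERIV_isCont)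
  then have "continuous_on UNIV h" by (simp add: continuous_at_imp_continuous_on)
  then have "continuous_on UNIV (h \<circ> (\<lambda>x. \<alpha> + x \<bullet> w))"
    by (intro continuous_on_compose continuous_intros) (auto intro: continuous_on_subset)
  then show ?case by (simp add: o_def)
next
  case (Suc k)
  obtain h' where h': "h' \<in> F" "\<And>s. (h has_real_derivative h' s) (at s)"
    using assms(1)[OF Suc.prems] by auto
  have "((\<lambda>x. h (\<alpha> + x \<bullet> w)) has_derivative (\<lambda>y. h' (\<alpha> + x \<bullet> w) * (y \<bullet> w))) (at x)" for x
    by (rule has_derivative_compose[where g = h])
      (use h'(2) in \<open>auto intro!: derivative_eq_intros simp: has_field_derivative_def\<close>)
  then show ?case
    by (rule Ck_SucI) (intro Ck_mult Ck_const Suc.IH h'(1))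
qed

text \<open>Differentiation maps \<open>P(1/s) exp(-1/s)\<close> to \<open>Q(1/s) exp(-1/s)\<close> with
  \<open>Q(y) = y\<^sup>2 (P(y) - P'(y))\<close>, so this family, extended by \<open>0\<close>, is closed under derivatives.\<close>

definition flat :: "real poly \<Rightarrow> real \<Rightarrow> real" where
  "flat P s = (if 0 < s then poly P (1 / s) * exp (- 1 / s) else 0)"

lemma poly_div_exp_tendsto_0: "((\<lambda>y. poly P y / exp y) \<longlongrightarrow> 0) (at_top :: real filter)"
proof -
  have "((\<lambda>y. \<Sum>i\<le>degree P. coeff P i * (y ^ i / exp y)) \<longlongrightarrow> (\<Sum>i\<le>degree P. coeff P i * 0)) (at_top :: real filter)"
    by (intro tendsto_sum tendsto_mult tendsto_const tendsto_power_div_exp_0)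
  then show ?thesis
    by (simp add: poly_altdef sum_divide_distrib)
qed

lemma flat_tendsto_0: "(flat P \<longlongrightarrow> 0) (at 0)"
proof -
  have "((\<lambda>s. poly P (inverse s) / exp (inverse s)) \<longlongrightarrow> 0) (at_right (0::real))"
    by (rule filterlim_compose[OF poly_div_exp_tendsto_0 filterlim_inverse_at_top_right])
  then have "(flat P \<longlongrightarrow> 0) (at_right 0)"
    by (rule Lim_transform_eventually)
      (auto simp: flat_def eventually_at_filter exp_minus divide_simps)
  moreover have "(flat P \<longlongrightarrow> 0) (at_left 0)"
    by (rule tendsto_eventually) (auto simp: flat_def eventually_at_filter)
  ultimately show ?thesis
    by (simp add: filterlim_split_at)
qed

lemma flat_has_derivative:
  "(flat P has_real_derivative flat ([:0, 0, 1:] * (P - pderiv P)) s) (at s)"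
proof (cases "s = 0")
  case True
  \<comment> \<open>Division by \<open>h\<close> multiplies a polynomial in \<open>1 / h\<close> by
    its variable, so the difference quotient at the origin belongs to the same family and tends to
    0.\<close>
  have "(\<lambda>h. (flat P h - flat P 0) / (h - 0)) = flat (pCons 0 P)"
    by (auto simp: flat_def fun_eq_iff)
  then have "(\<lambda>h. (flat P h - flat P 0) / (h - 0)) \<midarrow>0\<rightarrow> 0"
    by (simp only: flat_tendsto_0)
  then show ?thesis
    using True by (simp add: has_field_derivative_iff flat_def)
next
  case False
  show ?thesis
  proof (cases "0 < s")
    case True
    have "((\<lambda>s. poly P (1 / s) * exp (- 1 / s)) has_real_derivative
        flat ([:0, 0, 1:] * (P - pderiv P)) s) (at s)"
      using True
      by (auto intro!: derivative_eq_intros DERIV_chain2[OF poly_DERIV]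
          simp: flat_def field_simps power2_eq_square)
    then show ?thesis
      by (rule has_field_derivative_transform_within_open[of _ _ _ "{0<..}"])
        (use True in \<open>auto simp: flat_def\<close>)
  next
    case neg: False
    then have "s < 0" using False by simp
    have "((\<lambda>s. 0) has_real_derivative flat ([:0, 0, 1:] * (P - pderiv P)) s) (at s)"
      using neg by (auto simp: flat_def)
    then show ?thesis
      by (rule has_field_derivative_transform_within_open[of _ _ _ "{..<0}"])
        (use \<open>s < 0\<close> in \<open>auto simp: flat_def\<close>)
  qed
qed

text \<open>The parameter \<open>l\<close> leaves the support box unchanged and only steepens the
  flanks: inside the box each factor \<open>exp (- 1 / (l * s))\<close> rises to 1 as
  \<open>l\<close> grows. The bumps thus approximate the indicator of the open box from
  below.\<close>

definition bump :: "'a::euclidean_space \<Rightarrow> 'a \<Rightarrow> real \<Rightarrow> 'a \<Rightarrow> real" where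
  "bump a b l x = (\<Prod>i\<in>Basis. flat 1 (l * (x \<bullet> i - a \<bullet> i)) * flat 1 (l * (b \<bullet> i - x \<bullet> i)))"

lemma flat_1_bounds: "0 \<le> flat 1 s" "flat 1 s \<le> 1"
  by (auto simp: flat_def)

lemma bump_bounds: "0 \<le> bump a b l x" "bump a b l x \<le> 1"
  unfolding bump_def by (auto intro!: prod_nonneg prod_le_1 mult_nonneg_nonneg mult_le_one flat_1_bounds)

lemma bump_eq_0_iff: "0 < l \<Longrightarrow> bump a b l x = 0 \<longleftrightarrow> x \<notin> box a b"
  by (auto simp: bump_def flat_def mem_box zero_less_mult_iff)

lemma test_function_bump:
  assumes "0 < l" shows "test_function (bump a b l)"
proof -
  have flat: "\<exists>h'\<in>range flat. \<forall>s. (h has_real_derivative h' s) (at s)" if "h \<in> range flat" for h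
    using that flat_has_derivative by blast
  have "Ck k (\<lambda>x. flat 1 (l * (x \<bullet> i - a \<bullet> i)) * flat 1 (l * (b \<bullet> i - x \<bullet> i)))" for k i
  proof (rule Ck_mult)
    show "Ck k (\<lambda>x. flat 1 (l * (x \<bullet> i - a \<bullet> i)))"
      using Ck_ridge[OF flat rangeI, of k 1 "- l * (a \<bullet> i)" "l *\<^sub>R i"] by (simp add: algebra_simps)
    show "Ck k (\<lambda>x. flat 1 (l * (b \<bullet> i - x \<bullet> i)))"
      using Ck_ridge[OF flat rangeI, of k 1 "l * (b \<bullet> i)" "(- l) *\<^sub>R i"] by (simp add: algebra_simps)
  qed
  then have "Ck k (bump a b l)" for k
    unfolding bump_def[abs_def] by (intro Ck_prod) auto
  moreover have "bounded {x. bump a b l x \<noteq> 0}"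
    using bounded_subset[OF bounded_box[of a b]] assms by (auto simp: bump_eq_0_iff)
  ultimately show ?thesis
    by (simp add: test_function_def)
qed

lemma bump_tendsto_indicator:
  "(\<lambda>n. bump a b (real (Suc n)) x) \<longlonglongrightarrow> indicator (box a b) x"
proof (cases "x \<in> box a b")
  case True
  have flat: "(\<lambda>n. flat 1 (real (Suc n) * s)) \<longlonglongrightarrow> 1" if "0 < s" for s
  proof -
    have "(\<lambda>n. exp (- (1 / s) * (1 / real (Suc n)))) \<longlonglongrightarrow> exp (- (1 / s) * 0)"
      by (intro tendsto_intros LIMSEQ_Suc[OF lim_1_over_n])
    then show ?thesis
      using that by (simp add: flat_def zero_less_mult_iff field_simps del: of_nat_Suc)
  qed
  have "(\<lambda>n. bump a b (real (Suc n)) x) \<longlonglongrightarrow> (\<Prod>i\<in>(Basis :: 'a set). 1 * 1)"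
    unfolding bump_def
    by (intro tendsto_prod tendsto_mult flat) (use True in \<open>auto simp: mem_box\<close>)
  then show ?thesis using True by simp
next
  case False
  then have "bump a b (real (Suc n)) x = 0" for n
    by (simp add: bump_eq_0_iff)
  then show ?thesis using False by simp
qed

subsection \<open>Calculus of test functions\<close>

text \<open>Measurability is enough for the integral identity: if \<open>f\<close> is not
  integrable, both sides are the default value 0. The power term of \<open>J\<close> can therefore
  be dilated before its integrability is known.\<close>

lemma
  fixes f :: "'a::euclidean_space \<Rightarrow> 'b::{banach, second_countable_topology}"
  assumes c: "c \<noteq> 0" and f: "f \<in> borel_measurable lebesgue"
  shows integrable_lebesgue_affine_iff:
      "integrable lebesgue (\<lambda>x. f (t + c *\<^sub>R x)) \<longleftrightarrow> integrable lebesgue f"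
    and integral_lebesgue_affine:
      "integral\<^sup>L lebesgue f = \<bar>c\<bar> ^ DIM('a) *\<^sub>R (LINT x|lebesgue. f (t + c *\<^sub>R x))"
proof -
  have T: "(\<lambda>x. t + (\<Sum>j\<in>Basis. (c * (x \<bullet> j)) *\<^sub>R j)) = (\<lambda>x::'a. t + c *\<^sub>R x)"
    unfolding scaleR_scaleR[symmetric] scaleR_sum_right[symmetric] euclidean_representation ..
  have meas [measurable]: "(\<lambda>x::'a. t + c *\<^sub>R x) \<in> lebesgue \<rightarrow>\<^sub>M lebesgue"
    using lebesgue_affine_measurable[of "\<lambda>_. c" t] c by (simp add: T)
  have eq: "(lebesgue :: 'a measure) = density (distr lebesgue lebesgue (\<lambda>x. t + c *\<^sub>R x)) (\<lambda>_. ennreal (\<bar>c\<bar> ^ DIM('a)))"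
    using lebesgue_affine_euclidean[of "\<lambda>_. c" t] c by (simp add: T prod_constant ennreal_power)
  note [measurable] = f
  have "integrable lebesgue f \<longleftrightarrow> integrable lebesgue (\<lambda>x. \<bar>c\<bar> ^ DIM('a) *\<^sub>R f (t + c *\<^sub>R x))"
    by (subst (1) eq, subst integrable_density) (simp_all add: integrable_distr_eq)
  also have "\<dots> \<longleftrightarrow> integrable lebesgue (\<lambda>x. f (t + c *\<^sub>R x))"
  proof
    assume "integrable lebesgue (\<lambda>x. \<bar>c\<bar> ^ DIM('a) *\<^sub>R f (t + c *\<^sub>R x))"
    from integrable_scaleR_right[OF this, of "inverse (\<bar>c\<bar> ^ DIM('a))"]
    show "integrable lebesgue (\<lambda>x. f (t + c *\<^sub>R x))"
      using c by simp
  qed (rule integrable_scaleR_right)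
  finally show "integrable lebesgue (\<lambda>x. f (t + c *\<^sub>R x)) \<longleftrightarrow> integrable lebesgue f" ..
  show "integral\<^sup>L lebesgue f = \<bar>c\<bar> ^ DIM('a) *\<^sub>R (LINT x|lebesgue. f (t + c *\<^sub>R x))"
    by (subst eq, subst integral_density) (auto simp: integral_distr)
qed

section \<open>Gradients and supports of test functions\<close>

lemma has_derivative_grad:
  fixes f :: "'a::euclidean_space \<Rightarrow> real"
  assumes "f differentiable at x"
  shows "(f has_derivative (\<lambda>h. grad f x \<bullet> h)) (at x)"
proof -
  have "frechet_derivative f (at x) h = grad f x \<bullet> h" for h
    using linear_frechet_derivative[OF assms]
    by (subst (1) euclidean_representation[symmetric, of h])
      (simp add: linear_sum linear_cmul grad_def inner_sum_left inner_commute[of h] mult.commute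
        del: euclidean_representation)
  then show ?thesis
    using assms frechet_derivative_works[of f "at x"] by (metis (no_types, lifting) ext)
qed

lemma grad_eqI:
  fixes f :: "'a::euclidean_space \<Rightarrow> real"
  assumes "(f has_derivative (\<lambda>h. w \<bullet> h)) (at x)"
  shows "grad f x = w"
proof -
  have "frechet_derivative f (at x) b = w \<bullet> b" for b
    using frechet_derivative_at[OF assms] by metis
  then show ?thesis by (simp add: grad_def euclidean_representation)
qed

lemma test_function_has_derivative:
  assumes "test_function \<phi>"
  shows "(\<phi> has_derivative (\<lambda>h. grad \<phi> x \<bullet> h)) (at x)"
proof -
  have "Ck (Suc 0) \<phi>" using assms unfolding test_function_def by blast
  then show ?thesis
    by (intro has_derivative_grad) (simp add: differentiable_on_def)
qed

lemma test_function_continuous: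
  assumes "test_function \<phi>"
  shows "continuous_on UNIV \<phi>" "continuous_on UNIV (grad \<phi>)"
proof -
  have "Ck 0 \<phi>" "Ck (Suc 0) \<phi>" using assms unfolding test_function_def by blast+
  then show "continuous_on UNIV \<phi>" "continuous_on UNIV (grad \<phi>)"
    by (auto simp: grad_def[abs_def] intro!: continuous_intros)
qed

lemma test_function_measurable:
  assumes "test_function \<phi>"
  shows "\<phi> \<in> borel_measurable borel" "grad \<phi> \<in> borel_measurable borel"
  using test_function_continuous[OF assms] by (auto intro: borel_measurable_continuous_onI)

text \<open>A common compact set and constant for the function and its gradient, in the form
  required for domination. The gradient vanishes off the support because the complement is
  open.\<close>

lemma test_functionE:
  fixes \<phi> :: "'a::euclidean_space \<Rightarrow> real"
  assumes "test_function \<phi>"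
  obtains K B where "compact K" "0 \<le> B" "\<And>x. \<bar>\<phi> x\<bar> \<le> B * indicator K x"
    "\<And>x. norm (grad \<phi> x) \<le> B * indicator K x"
proof -
  define K where "K = closure {x. \<phi> x \<noteq> 0}"
  have K: "compact K" using assms by (simp add: K_def test_function_def)
  have out: "\<phi> x = 0 \<and> grad \<phi> x = 0" if "x \<notin> K" for x
  proof
    have zero: "\<phi> y = 0" if "y \<in> - K" for y
      using that closure_subset[of "{x. \<phi> x \<noteq> 0}"] by (auto simp: K_def)
    then show "\<phi> x = 0" using that by simp
    have "(\<phi> has_derivative (\<lambda>h. 0 \<bullet> h)) (at x)"
      by (rule has_derivative_transform_within_open[of "\<lambda>x. 0" _ _ _ "- K"])
        (use that zero K in \<open>auto simp: open_Compl compact_imp_closed\<close>)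
    then show "grad \<phi> x = 0" by (rule grad_eqI)
  qed
  have "bounded (\<phi> ` K)" "bounded (grad \<phi> ` K)"
    using test_function_continuous[OF assms] K
    by (auto intro!: compact_imp_bounded compact_continuous_image elim: continuous_on_subset)
  then obtain B1 B2 where B: "\<And>x. x \<in> K \<Longrightarrow> \<bar>\<phi> x\<bar> \<le> B1" "\<And>x. x \<in> K \<Longrightarrow> norm (grad \<phi> x) \<le> B2"
    by (auto simp: bounded_iff)
  show ?thesis
  proof (rule that[of K "max 0 (max B1 B2)"])
    show "\<bar>\<phi> x\<bar> \<le> max 0 (max B1 B2) * indicator K x" "norm (grad \<phi> x) \<le> max 0 (max B1 B2) * indicator K x" for x
      using B[of x] out[of x] by (cases "x \<in> K"; auto)+
  qed (use K in auto)
qed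

lemma test_function_mult:
  assumes "test_function \<phi>" "test_function \<psi>"
  shows "test_function (\<lambda>x. \<phi> x * \<psi> x)" "grad (\<lambda>x. \<phi> x * \<psi> x) x = \<phi> x *\<^sub>R grad \<psi> x + \<psi> x *\<^sub>R grad \<phi> x"
proof -
  have "bounded {x. \<phi> x * \<psi> x \<noteq> 0}"
    using assms(1) by (auto simp: test_function_def elim: bounded_subset)
  then show "test_function (\<lambda>x. \<phi> x * \<psi> x)"
    using assms by (auto simp: test_function_def intro: Ck_mult)
  show "grad (\<lambda>x. \<phi> x * \<psi> x) x = \<phi> x *\<^sub>R grad \<psi> x + \<psi> x *\<^sub>R grad \<phi> x"
    by (rule grad_eqI)
      (rule has_derivative_eq_rhs[OF has_derivative_mult[OF test_function_has_derivative[OF assms(1)]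
              test_function_has_derivative[OF assms(2)]]], auto simp: inner_simps)
qed

lemma test_function_scale:
  fixes \<phi> :: "'a::euclidean_space \<Rightarrow> real"
  assumes "test_function \<phi>" "r \<noteq> 0"
  shows "test_function (\<lambda>x. \<phi> (r *\<^sub>R x))" "grad (\<lambda>x. \<phi> (r *\<^sub>R x)) x = r *\<^sub>R grad \<phi> (r *\<^sub>R x)"
proof -
  have "bounded {x. \<phi> x \<noteq> 0}"
    using assms by (auto simp: test_function_def)
  then have "bounded ((\<lambda>x. inverse r *\<^sub>R x) ` {x. \<phi> x \<noteq> 0})"
    by (rule bounded_scaling)
  moreover have "{x. \<phi> (r *\<^sub>R x) \<noteq> 0} \<subseteq> (\<lambda>x. inverse r *\<^sub>R x) ` {x. \<phi> x \<noteq> 0}"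
    using \<open>r \<noteq> 0\<close> by (force intro: image_eqI[where x = "r *\<^sub>R x" for x])
  ultimately show "test_function (\<lambda>x. \<phi> (r *\<^sub>R x))"
    using assms by (auto simp: test_function_def intro: Ck_scale bounded_subset)
  show "grad (\<lambda>x. \<phi> (r *\<^sub>R x)) x = r *\<^sub>R grad \<phi> (r *\<^sub>R x)"
    by (rule grad_eqI)
      (rule has_derivative_eq_rhs[OF has_derivative_compose[OF _ test_function_has_derivative[OF assms(1)]]],
        auto intro!: derivative_eq_intros)
qed

lemma integrable_compact_support_bound:
  fixes f :: "'a::euclidean_space \<Rightarrow> 'b::{banach, second_countable_topology}"
    and h :: "'a \<Rightarrow> 'c::{banach, second_countable_topology}"
  assumes "set_integrable lebesgue K f" "h \<in> borel_measurable lebesgue"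
    and bound: "\<And>x. norm (h x) \<le> B * indicator K x * norm (f x)"
  shows "integrable lebesgue h"
proof (rule Bochner_Integration.integrable_bound)
  show "integrable lebesgue (\<lambda>x. B * norm (indicator K x *\<^sub>R f x))"
    using integrable_norm[OF assms(1)[unfolded set_integrable_def]] by (rule integrable_mult_right)
  show "AE x in lebesgue. norm (h x) \<le> norm (B * norm (indicator K x *\<^sub>R f x))"
    using order_trans[OF bound abs_ge_self] by (simp add: abs_mult mult.assoc)
qed fact

lemma integrable_bounded_compact_support:
  fixes f :: "'a::euclidean_space \<Rightarrow> 'b::{banach, second_countable_topology}"
  assumes "compact K" "f \<in> borel_measurable lebesgue" "\<And>x. norm (f x) \<le> B * indicator K x"
  shows "integrable lebesgue f"
proof (rule Bochner_Integration.integrable_bound)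
  have "integrable lebesgue (indicator K :: 'a \<Rightarrow> real)"
    using lmeasurable_compact[OF assms(1)]
    by (intro integrable_real_indicator) (simp_all only: fmeasurable_def mem_Collect_eq)
  then show "integrable lebesgue (\<lambda>x. B * indicator K x :: real)" by auto
  show "AE x in lebesgue. norm (f x) \<le> norm (B * indicator K x :: real)"
    using assms(3) by (auto intro!: AE_I2 order_trans[OF assms(3)])
qed (use assms in auto)

lemma integrable_test_function:
  assumes "test_function \<phi>"
  shows "integrable lebesgue \<phi>" "integrable lebesgue (grad \<phi>)"
proof -
  from assms obtain K B where "compact K" "\<And>x. \<bar>\<phi> x\<bar> \<le> B * indicator K x"
    "\<And>x. norm (grad \<phi> x) \<le> B * indicator K x" using test_functionE by metis
  then show "integrable lebesgue \<phi>" "integrable lebesgue (grad \<phi>)"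
    using test_function_measurable[OF assms]
    by (auto intro!: integrable_bounded_compact_support[of K] measurable_completion)
qed

text \<open>The difference quotients in a coordinate direction have integral \<open>0\<close> by translation
  invariance; this avoids Fubini and passes to the limit by dominated convergence.\<close>

lemma integral_grad_test_function:
  fixes \<phi> :: "'a::euclidean_space \<Rightarrow> real"
  assumes \<phi>: "test_function \<phi>"
  shows "(LINT x|lebesgue. grad \<phi> x) = 0"
proof (rule euclidean_eqI)
  fix b :: 'a assume b: "b \<in> Basis"
  obtain K B where K: "compact K" "0 \<le> B" "\<And>x. \<bar>\<phi> x\<bar> \<le> B * indicator K x"
    "\<And>x. norm (grad \<phi> x) \<le> B * indicator K x"
    using \<phi> test_functionE by metis
  obtain R where R: "K \<subseteq> cball 0 R"
    using compact_imp_bounded[OF K(1)] by (auto simp: bounded_iff subset_iff)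
  \<comment> \<open>Step sizes of at most 1 keep the supports of all difference quotients in one
    ball of radius \<open>R + 1\<close>, which together with the Lipschitz bound gives an integrable
    majorant.\<close>
  define h :: "nat \<Rightarrow> real" where "h n = 1 / real (Suc n)" for n
  have h: "0 < h n" "h n \<le> 1" for n by (auto simp: h_def)
  have h0: "h \<longlonglongrightarrow> 0" unfolding h_def by (rule LIMSEQ_Suc[OF lim_1_over_n])
  \<comment> \<open>The factor \<open>1\<close> is written out so that the translation has the shape
    of the affine change of variables.\<close>
  define D where "D n x = (\<phi> (h n *\<^sub>R b + 1 *\<^sub>R x) - \<phi> x) / h n" for n x
  note [measurable] = test_function_measurable[OF \<phi>]
  have lip: "norm (\<phi> x - \<phi> y) \<le> B * norm (x - y)" for x y
  proof (rule differentiable_bound[OF convex_UNIV])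
    show "(\<phi> has_derivative (\<lambda>h. grad \<phi> x \<bullet> h)) (at x within UNIV)" for x
      using test_function_has_derivative[OF \<phi>] by simp
    show "onorm (\<lambda>h. grad \<phi> x \<bullet> h) \<le> B" for x
    proof (rule onorm_bound[OF K(2)])
      fix y
      have "norm (grad \<phi> x) \<le> B"
        using K(4)[of x] K(2) by (cases "x \<in> K") auto
      then show "norm (grad \<phi> x \<bullet> y) \<le> B * norm y"
        by (metis Cauchy_Schwarz_ineq2 mult_right_mono norm_ge_zero order_trans real_norm_def)
    qed
  qed auto
  have bound: "norm (D n x) \<le> B * indicator (cball 0 (R + 1)) x" for n x
  proof (cases "x \<in> cball 0 (R + 1)")
    case True
    have "\<bar>\<phi> (h n *\<^sub>R b + x) - \<phi> x\<bar> \<le> B * h n"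
      using lip[of "h n *\<^sub>R b + x" x] b h[of n] by simp
    then show ?thesis
      using True h[of n] by (simp add: D_def divide_le_eq)
  next
    case False
    have "norm (h n *\<^sub>R b) \<le> 1" using b h[of n] by simp
    then have "R < norm (h n *\<^sub>R b + x)" "R < norm x"
      using False norm_triangle_ineq4[of "h n *\<^sub>R b + x" "h n *\<^sub>R b"] by auto
    then have "h n *\<^sub>R b + x \<notin> K" "x \<notin> K" using R by auto
    then have "\<phi> (h n *\<^sub>R b + x) = 0" "\<phi> x = 0"
      using K(3)[of x] K(3)[of "h n *\<^sub>R b + x"] by auto
    then show ?thesis using K(2) by (simp add: D_def)
  qed
  have lim: "(\<lambda>n. D n x) \<longlonglongrightarrow> grad \<phi> x \<bullet> b" for x
  proof -
    have "((\<lambda>s. \<phi> (s *\<^sub>R b + x)) has_derivative (\<lambda>s. grad \<phi> x \<bullet> (s *\<^sub>R b))) (at 0)"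
    proof (rule has_derivative_compose[where f = "\<lambda>s. s *\<^sub>R b + x" and f' = "\<lambda>s. s *\<^sub>R b"])
      show "((\<lambda>s. s *\<^sub>R b + x) has_derivative (\<lambda>s. s *\<^sub>R b)) (at 0)"
        by (auto intro!: derivative_eq_intros)
      show "(\<phi> has_derivative (\<lambda>h. grad \<phi> x \<bullet> h)) (at (0 *\<^sub>R b + x))"
        using test_function_has_derivative[OF \<phi>] by simp
    qed
    then have "((\<lambda>s. \<phi> (s *\<^sub>R b + x)) has_real_derivative (grad \<phi> x \<bullet> b)) (at 0)"
      by (rule has_derivative_imp_has_field_derivative) simp
    then have "((\<lambda>s. (\<phi> (s *\<^sub>R b + x) - \<phi> x) / s) \<longlongrightarrow> grad \<phi> x \<bullet> b) (at 0)"
      by (simp add: has_field_derivative_iff)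
    moreover have "filterlim h (at 0) sequentially"
      using h(1) by (intro filterlim_atI[OF h0] always_eventually) (auto simp: less_le)
    ultimately show ?thesis
      unfolding D_def scaleR_one by (rule filterlim_compose)
  qed
  have int: "integrable lebesgue (\<lambda>x. \<phi> (h n *\<^sub>R b + 1 *\<^sub>R x))" for n
    by (subst integrable_lebesgue_affine_iff) (auto intro: integrable_test_function[OF \<phi>] measurable_completion)
  have "(\<lambda>n. LINT x|lebesgue. D n x) \<longlonglongrightarrow> (LINT x|lebesgue. grad \<phi> x \<bullet> b)"
  proof (rule integral_dominated_convergence)
    show "integrable lebesgue (\<lambda>x. B * indicator (cball 0 (R + 1)) x :: real)"
      using K(2) by (intro integrable_bounded_compact_support[of "cball 0 (R + 1)" _ B]) (auto intro!: borel_measurable_times borel_measurable_indicator)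
    show "D n \<in> borel_measurable lebesgue" for n
      unfolding D_def by (rule measurable_completion) simp
    show "(\<lambda>x. grad \<phi> x \<bullet> b) \<in> borel_measurable lebesgue"
      by (rule measurable_completion) simp
  qed (use lim bound in auto)
  moreover have "(LINT x|lebesgue. D n x) = 0" for n
    using integral_lebesgue_affine[of 1 \<phi> "h n *\<^sub>R b"] int[of n] integrable_test_function[OF \<phi>]
    by (simp add: D_def measurable_completion)
  ultimately have "(LINT x|lebesgue. grad \<phi> x \<bullet> b) = 0"
    by (simp add: LIMSEQ_const_iff)
  then show "(LINT x|lebesgue. grad \<phi> x) \<bullet> b = 0 \<bullet> b"
    using integrable_test_function[OF \<phi>] by (simp add: integral_inner_left)
qed

subsection \<open>Weak gradients\<close>

lemma test_function_measurable_lebesgue: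
  assumes "test_function \<phi>"
  shows "\<phi> \<in> borel_measurable lebesgue" "grad \<phi> \<in> borel_measurable lebesgue"
  using test_function_measurable[OF assms] by (auto intro: measurable_completion)

section \<open>The fundamental lemma of the calculus of variations\<close>

lemma sigma_finite_lebesgue: "sigma_finite_measure (lebesgue :: 'a::euclidean_space measure)"
proof
  obtain A :: "'a set set" where A: "countable A" "A \<subseteq> sets lborel" "\<Union>A = space lborel"
    "\<forall>a\<in>A. emeasure lborel a \<noteq> \<infinity>"
    using lborel.sigma_finite_countable by blast
  have sets: "A \<subseteq> sets lebesgue"
    using A(2) by (auto intro: sets_completionI_sets)
  have fin: "\<forall>a\<in>A. emeasure lebesgue a \<noteq> \<infinity>"
    using A(2,4) by (metis emeasure_completion main_part sets_completionI_sets subsetD)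
  show "\<exists>A. countable A \<and> A \<subseteq> sets (lebesgue :: 'a measure) \<and> \<Union>A = space lebesgue \<and> (\<forall>a\<in>A. emeasure lebesgue a \<noteq> \<infinity>)"
    by (intro exI[of _ A] conjI A(1) sets fin) (use A(3) in simp)
qed

text \<open>Boxes are an intersection-stable generator of the Borel sets, so a Dynkin argument
  carries the vanishing integrals to Borel sets, and null sets carry them on to Lebesgue sets.
  Complements require an integrable function, hence the cut-off to a large box; countably many such
  boxes exhaust the space.\<close>

lemma integral_zero_on_boxes_imp_AE_zero:
  fixes g :: "'a::euclidean_space \<Rightarrow> 'b::{banach, second_countable_topology}"
  assumes int: "\<And>a b. set_integrable lebesgue (box a b) g"
    and zero: "\<And>a b. (LINT x:box a b|lebesgue. g x) = 0"
  shows "AE x in lebesgue. g x = 0"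
proof -
  have "AE x in lebesgue. x \<in> box (- (real n *\<^sub>R One)) (real n *\<^sub>R One) \<longrightarrow> g x = 0" for n
  proof -
    define B where "B = box (- (real n *\<^sub>R One)) (real n *\<^sub>R One :: 'a)"
    define h where "h x = indicator B x *\<^sub>R g x" for x
    have h: "integrable lebesgue h"
      using int unfolding h_def B_def set_integrable_def .
    then have int_h: "set_integrable lebesgue A h" if "A \<in> sets lebesgue" for A
      using that by (simp add: set_integrable_def integrable_mult_indicator)
    have borel: "(LINT x:A|lebesgue. h x) = 0" if "A \<in> sets borel" for A
    proof -
      let ?G = "range (\<lambda>(a, b). box a b :: 'a set)"
      have sigma: "sets borel = sigma_sets (UNIV :: 'a set) ?G"
        by (simp add: borel_eq_box)
      have "Int_stable ?G" "?G \<subseteq> Pow UNIV" "A \<in> sigma_sets UNIV ?G"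
        using that sigma by (auto simp: Int_stable_def box_Int_box)
      then show ?thesis
      proof (induction rule: sigma_sets_induct_disjoint)
        case (basic A)
        then obtain a b where A: "A = box a b" by auto
        \<comment> \<open>Boxes are closed under intersection, so integrals of the cut-off function
          over boxes are integrals of \<open>g\<close> over boxes.\<close>
        obtain a' b' where "box a b \<inter> B = box a' b'"
          unfolding B_def box_Int_box by blast
        then have "(LINT x:A|lebesgue. h x) = (LINT x:box a' b'|lebesgue. g x)"
          unfolding set_lebesgue_integral_def h_def A
          by (intro Bochner_Integration.integral_cong) (auto simp: indicator_def)
        then show ?case using zero by simp
      next
        case empty
        show ?case by (simp add: set_lebesgue_integral_def)
      next
        case (compl A)
        then have A: "A \<in> sets lebesgue" using sigma by auto
        have "(LINT x:UNIV - A|lebesgue. h x) = (LINT x|lebesgue. h x - indicator A x *\<^sub>R h x)"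
          unfolding set_lebesgue_integral_def
          by (intro Bochner_Integration.integral_cong) (auto simp: indicator_def)
        also have "\<dots> = (LINT x|lebesgue. h x) - (LINT x:A|lebesgue. h x)"
          using h int_h[OF A] unfolding set_lebesgue_integral_def set_integrable_def
          by (rule Bochner_Integration.integral_diff)
        also have "(LINT x|lebesgue. h x) = 0"
          using zero[of "- (real n *\<^sub>R One)" "real n *\<^sub>R One"]
          by (simp add: set_lebesgue_integral_def h_def[abs_def] B_def)
        finally show ?case using compl by simp
      next
        case (union A)
        then have "A i \<in> sets borel" for i unfolding sigma by auto
        then have A: "A i \<in> sets lebesgue" for i by simp
        have "(LINT x:(\<Union>i. A i)|lebesgue. h x) = (\<Sum>i. LINT x:A i|lebesgue. h x)"
          using union(1) A by (intro lebesgue_integral_countable_add int_h) (auto simp: disjoint_family_on_def)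
        then show ?case using union by simp
      qed
    qed
    have "AE x in lebesgue. h x = 0"
    proof (rule sigma_finite_measure.density_zero[OF sigma_finite_lebesgue h])
      fix A :: "'a set" assume "A \<in> sets lebesgue"
      then obtain S N N' where A: "A = S \<union> N" "N \<subseteq> N'" "N' \<in> null_sets lborel" "S \<in> sets lborel"
        by (rule sets_completionE)
      have "AE x in lborel. x \<notin> N'" using A(3) by (rule AE_not_in)
      then have "AE x in lebesgue. x \<notin> N'" by (rule AE_completion)
      then have "(LINT x:A|lebesgue. h x) = (LINT x:S|lebesgue. h x)"
        unfolding set_lebesgue_integral_def
        using h \<open>A \<in> sets lebesgue\<close> A
        by (intro integral_cong_AE borel_measurable_scaleR borel_measurable_indicator)
          (auto elim!: eventually_mono simp: indicator_def)
      then show "(LINT x:A|lebesgue. h x) = 0" using borel[of S] A by simp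
    qed
    then show ?thesis
      unfolding h_def B_def by (auto elim!: eventually_mono)
  qed
  then have "AE x in lebesgue. \<forall>n. x \<in> box (- (real n *\<^sub>R One)) (real n *\<^sub>R One) \<longrightarrow> g x = 0"
    by (subst AE_all_countable) blast
  then show ?thesis
  proof (rule eventually_mono)
    fix x :: 'a
    assume *: "\<forall>n. x \<in> box (- (real n *\<^sub>R One)) (real n *\<^sub>R One) \<longrightarrow> g x = 0"
    have "x \<in> (\<Union>n::nat. box (- (real n *\<^sub>R One)) (real n *\<^sub>R One))"
      by (simp only: UN_box_eq_UNIV UNIV_I)
    with * show "g x = 0" by blast
  qed
qed

text \<open>Bumps converge to the indicator of an open box, which reduces the claim to vanishing
  integrals over boxes. The majorant lives on the closed box, since local integrability speaks of
  compact sets.\<close>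

lemma locally_integrable_test_function_zero_imp_AE_zero:
  fixes f :: "'a::euclidean_space \<Rightarrow> 'b::euclidean_space"
  assumes f: "locally_integrable f"
    and zero: "\<And>\<phi>. test_function \<phi> \<Longrightarrow> (LINT x|lebesgue. \<phi> x *\<^sub>R f x) = 0"
  shows "AE x in lebesgue. f x = 0"
proof (rule integral_zero_on_boxes_imp_AE_zero)
  fix a b :: 'a
  have cbox: "set_integrable lebesgue (cbox a b) f"
    using f by (simp add: locally_integrable_def)
  then show "set_integrable lebesgue (box a b) f"
    by (rule set_integrable_subset) (auto simp: box_subset_cbox)
  have "(\<lambda>n. LINT x|lebesgue. bump a b (real (Suc n)) x *\<^sub>R f x) \<longlonglongrightarrow>
      (LINT x|lebesgue. indicator (box a b) x *\<^sub>R f x)"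
  proof (rule integral_dominated_convergence)
    show "integrable lebesgue (\<lambda>x. norm (indicator (cbox a b) x *\<^sub>R f x))"
      using cbox by (intro integrable_norm) (simp add: set_integrable_def)
    show "(\<lambda>x. bump a b (real (Suc n)) x *\<^sub>R f x) \<in> borel_measurable lebesgue" for n
      using f test_function_measurable_lebesgue(1)[OF test_function_bump[of "real (Suc n)" a b]]
      by (intro borel_measurable_scaleR) (auto simp: locally_integrable_def)
    show "(\<lambda>x. indicator (box a b) x *\<^sub>R f x) \<in> borel_measurable lebesgue"
      using f by (intro borel_measurable_scaleR borel_measurable_indicator) (auto simp: locally_integrable_def)
    show "AE x in lebesgue. (\<lambda>n. bump a b (real (Suc n)) x *\<^sub>R f x) \<longlonglongrightarrow> indicator (box a b) x *\<^sub>R f x"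
      by (intro AE_I2 tendsto_scaleR bump_tendsto_indicator tendsto_const)
    show "AE x in lebesgue. norm (bump a b (real (Suc n)) x *\<^sub>R f x) \<le> norm (indicator (cbox a b) x *\<^sub>R f x)" for n
    proof (rule AE_I2)
      fix x
      show "norm (bump a b (real (Suc n)) x *\<^sub>R f x) \<le> norm (indicator (cbox a b) x *\<^sub>R f x)"
      proof (cases "x \<in> box a b")
        case True
        then have "x \<in> cbox a b" using box_subset_cbox by blast
        then show ?thesis
          using bump_bounds[of a b "real (Suc n)" x] by (simp add: mult_left_le_one_le)
      next
        case False
        then have "bump a b (real (Suc n)) x = 0" by (simp add: bump_eq_0_iff)
        then show ?thesis by simp
      qed
    qed
  qed
  moreover have "(LINT x|lebesgue. bump a b (real (Suc n)) x *\<^sub>R f x) = 0" for n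
    by (rule zero) (simp add: test_function_bump)
  ultimately show "(LINT x:box a b|lebesgue. f x) = 0"
    by (simp add: LIMSEQ_const_iff set_lebesgue_integral_def)
qed

lemma integrable_test_function_scaleR:
  fixes u :: "'a::euclidean_space \<Rightarrow> real" and g :: "'a \<Rightarrow> 'b::euclidean_space"
  assumes "test_function \<phi>"
  shows "locally_integrable u \<Longrightarrow> integrable lebesgue (\<lambda>x. u x *\<^sub>R grad \<phi> x)"
    and "locally_integrable g \<Longrightarrow> integrable lebesgue (\<lambda>x. \<phi> x *\<^sub>R g x)"
proof -
  obtain K B where K: "compact K" "0 \<le> B" "\<And>x. \<bar>\<phi> x\<bar> \<le> B * indicator K x"
    "\<And>x. norm (grad \<phi> x) \<le> B * indicator K x"
    using assms test_functionE by metis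
  note [measurable] = test_function_measurable_lebesgue[OF assms]
  show "integrable lebesgue (\<lambda>x. u x *\<^sub>R grad \<phi> x)" if "locally_integrable u"
    using that K mult_left_mono[OF K(4), of "\<bar>u x\<bar>" for x]
    by (intro integrable_compact_support_bound[of K u _ B]) (auto simp: locally_integrable_def mult_ac)
  show "integrable lebesgue (\<lambda>x. \<phi> x *\<^sub>R g x)" if "locally_integrable g"
    using that K mult_right_mono[OF K(3), of "norm (g x)" for x]
    by (intro integrable_compact_support_bound[of K g _ B]) (auto simp: locally_integrable_def)
qed

section \<open>Local integrability and rules for weak gradients\<close>

lemma locally_integrable_integrable:
  assumes "integrable lebesgue f" shows "locally_integrable f"
  unfolding locally_integrable_def set_integrable_def
proof (intro conjI allI impI integrable_mult_indicator assms)
  show "K \<in> sets lebesgue" if "compact K" for K :: "'a set"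
    using compact_imp_closed[OF that] by simp
qed (use assms in simp)

lemma locally_integrable_add:
  "locally_integrable f \<Longrightarrow> locally_integrable g \<Longrightarrow> locally_integrable (\<lambda>x. f x + g x)"
  by (auto simp: locally_integrable_def intro: set_integral_add)

lemma locally_integrable_scaleR:
  "locally_integrable f \<Longrightarrow> locally_integrable (\<lambda>x. c *\<^sub>R f x)"
  by (auto simp: locally_integrable_def intro: set_integrable_scaleR_right)

lemma locally_integrable_dilation:
  fixes f :: "'a::euclidean_space \<Rightarrow> 'b::euclidean_space"
  assumes "locally_integrable f" "s \<noteq> 0"
  shows "locally_integrable (\<lambda>x. f (s *\<^sub>R x))"
  unfolding locally_integrable_def
proof (intro conjI allI impI)
  have [measurable]: "f \<in> borel_measurable lebesgue"
    using assms by (simp add: locally_integrable_def)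
  show "(\<lambda>x. f (s *\<^sub>R x)) \<in> borel_measurable lebesgue"
    by measurable
  fix K :: "'a set" assume "compact K"
  then have "set_integrable lebesgue ((*\<^sub>R) s ` K) f"
    using assms(1) by (simp add: locally_integrable_def compact_scaling)
  moreover have "indicator ((*\<^sub>R) s ` K) (s *\<^sub>R x) = (indicator K x :: real)" for x
    using assms(2) by (auto simp: indicator_def)
  ultimately show "set_integrable lebesgue K (\<lambda>x. f (s *\<^sub>R x))"
    using integrable_lebesgue_affine_iff[OF assms(2), of "\<lambda>x. indicator ((*\<^sub>R) s ` K) x *\<^sub>R f x" 0]
    by (auto simp: set_integrable_def dest: borel_measurable_integrable)
qed

text \<open>This makes the arbitrary choice in \<open>weak_grad\<close> harmless: explicit gradients
  of dilated and perturbed functions may replace it under every integral.\<close>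

lemma has_weak_grad_unique:
  assumes "has_weak_grad u g" "has_weak_grad u g'"
  shows "AE x in lebesgue. g x = g' x"
proof -
  have loc: "locally_integrable g" "locally_integrable g'"
    using assms by (auto simp: has_weak_grad_def)
  have "AE x in lebesgue. g x + (- 1) *\<^sub>R g' x = 0"
  proof (rule locally_integrable_test_function_zero_imp_AE_zero)
    fix \<phi> :: "'a \<Rightarrow> real" assume \<phi>: "test_function \<phi>"
    then have "(LINT x|lebesgue. \<phi> x *\<^sub>R g x) = (LINT x|lebesgue. \<phi> x *\<^sub>R g' x)"
      using assms by (simp add: has_weak_grad_def)
    then show "(LINT x|lebesgue. \<phi> x *\<^sub>R (g x + (- 1) *\<^sub>R g' x)) = 0"
      using integrable_test_function_scaleR(2)[OF \<phi> loc(1)] integrable_test_function_scaleR(2)[OF \<phi> loc(2)]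
      by (simp add: scaleR_diff_right)
  qed (intro locally_integrable_add locally_integrable_scaleR loc)
  then show ?thesis by (auto elim: eventually_mono)
qed

lemma has_weak_grad_weak_grad: "has_weak_grad u g \<Longrightarrow> has_weak_grad u (weak_grad u)"
  unfolding weak_grad_def by (rule someI[of "has_weak_grad u"])

lemma has_weak_grad_add:
  assumes "has_weak_grad u g" "has_weak_grad u' g'"
  shows "has_weak_grad (\<lambda>x. u x + u' x) (\<lambda>x. g x + g' x)"
  unfolding has_weak_grad_def
proof (intro conjI allI impI)
  fix \<phi> :: "'a \<Rightarrow> real" assume \<phi>: "test_function \<phi>"
  show "(LINT x|lebesgue. (u x + u' x) *\<^sub>R grad \<phi> x) = - (LINT x|lebesgue. \<phi> x *\<^sub>R (g x + g' x))"
    using assms \<phi> integrable_test_function_scaleR(1)[OF \<phi>, of u] integrable_test_function_scaleR(1)[OF \<phi>, of u']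
      integrable_test_function_scaleR(2)[OF \<phi>, of g] integrable_test_function_scaleR(2)[OF \<phi>, of g']
    by (simp add: has_weak_grad_def scaleR_add_left scaleR_add_right)
qed (use assms in \<open>auto simp: has_weak_grad_def intro: locally_integrable_add\<close>)

lemma has_weak_grad_cmult:
  assumes "has_weak_grad u g"
  shows "has_weak_grad (\<lambda>x. c * u x) (\<lambda>x. c *\<^sub>R g x)"
  unfolding has_weak_grad_def
proof (intro conjI allI impI)
  fix \<phi> :: "'a \<Rightarrow> real" assume \<phi>: "test_function \<phi>"
  have "(LINT x|lebesgue. \<phi> x *\<^sub>R c *\<^sub>R g x) = (LINT x|lebesgue. c *\<^sub>R \<phi> x *\<^sub>R g x)"
    by (simp add: mult.commute)
  then show "(LINT x|lebesgue. (c * u x) *\<^sub>R grad \<phi> x) = - (LINT x|lebesgue. \<phi> x *\<^sub>R c *\<^sub>R g x)"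
    using assms \<phi> by (simp add: has_weak_grad_def flip: scaleR_scaleR del: scaleR_scaleR)
next
  show "locally_integrable (\<lambda>x. c * u x)"
    using locally_integrable_scaleR[of u c] assms by (simp add: has_weak_grad_def)
qed (use assms in \<open>auto simp: has_weak_grad_def intro: locally_integrable_scaleR\<close>)

lemma has_weak_grad_dilation:
  fixes u :: "'a::euclidean_space \<Rightarrow> real"
  assumes "has_weak_grad u g" "0 < s"
  shows "has_weak_grad (\<lambda>x. u (s *\<^sub>R x)) (\<lambda>x. s *\<^sub>R g (s *\<^sub>R x))"
  unfolding has_weak_grad_def
proof (intro conjI allI impI)
  have u: "locally_integrable u" and g: "locally_integrable g"
    using assms by (auto simp: has_weak_grad_def)
  show "locally_integrable (\<lambda>x. u (s *\<^sub>R x))" "locally_integrable (\<lambda>x. s *\<^sub>R g (s *\<^sub>R x))"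
    using assms u g by (auto intro: locally_integrable_dilation locally_integrable_scaleR)
  fix \<phi> :: "'a \<Rightarrow> real" assume \<phi>: "test_function \<phi>"
  \<comment> \<open>Moving the dilation onto the test function turns the claim into the hypothesis
    at \<open>\<psi>\<close>; both integrals pick up the same factor \<open>s ^ DIM('a)\<close>,
    which cancels.\<close>
  define \<psi> where "\<psi> x = \<phi> (inverse s *\<^sub>R x)" for x
  have \<psi>: "test_function \<psi>" and grad: "grad \<phi> x = s *\<^sub>R grad \<psi> (s *\<^sub>R x)" for x
    using test_function_scale[OF \<phi>, of "inverse s"] assms(2) by (auto simp: \<psi>_def[abs_def])
  have m: "(\<lambda>x. u x *\<^sub>R grad \<psi> x) \<in> borel_measurable lebesgue" "(\<lambda>x. \<psi> x *\<^sub>R g x) \<in> borel_measurable lebesgue"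
    using integrable_test_function_scaleR[OF \<psi>] u g by (auto dest: borel_measurable_integrable)
  have "s ^ DIM('a) *\<^sub>R (LINT x|lebesgue. u (s *\<^sub>R x) *\<^sub>R grad \<psi> (s *\<^sub>R x))
      = - (s ^ DIM('a) *\<^sub>R (LINT x|lebesgue. \<psi> (s *\<^sub>R x) *\<^sub>R g (s *\<^sub>R x)))"
    using integral_lebesgue_affine[OF _ m(1), of s 0] integral_lebesgue_affine[OF _ m(2), of s 0]
      assms \<psi> by (simp add: has_weak_grad_def)
  then have "s ^ DIM('a) *\<^sub>R ((LINT x|lebesgue. u (s *\<^sub>R x) *\<^sub>R grad \<psi> (s *\<^sub>R x))
      + (LINT x|lebesgue. \<psi> (s *\<^sub>R x) *\<^sub>R g (s *\<^sub>R x))) = 0"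
    by (simp add: scaleR_add_right)
  then have eq: "(LINT x|lebesgue. u (s *\<^sub>R x) *\<^sub>R grad \<psi> (s *\<^sub>R x)) = - (LINT x|lebesgue. \<psi> (s *\<^sub>R x) *\<^sub>R g (s *\<^sub>R x))"
    using assms(2) by (simp add: eq_neg_iff_add_eq_0)
  have "(LINT x|lebesgue. u (s *\<^sub>R x) *\<^sub>R grad \<phi> x) = (LINT x|lebesgue. s *\<^sub>R u (s *\<^sub>R x) *\<^sub>R grad \<psi> (s *\<^sub>R x))"
    by (simp add: grad mult.commute)
  also have "\<dots> = - (LINT x|lebesgue. s *\<^sub>R \<psi> (s *\<^sub>R x) *\<^sub>R g (s *\<^sub>R x))"
    by (simp add: eq del: scaleR_scaleR)
  also have "\<dots> = - (LINT x|lebesgue. \<phi> x *\<^sub>R s *\<^sub>R g (s *\<^sub>R x))"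
    using assms(2) by (simp add: \<psi>_def mult.commute)
  finally show "(LINT x|lebesgue. u (s *\<^sub>R x) *\<^sub>R grad \<phi> x) = - (LINT x|lebesgue. \<phi> x *\<^sub>R s *\<^sub>R g (s *\<^sub>R x))" .
qed

text \<open>Integration by parts is the product rule for \<open>\<psi> \<phi>\<close> combined with
  the vanishing integral of the gradient of a test function.\<close>

lemma has_weak_grad_test_function:
  assumes \<psi>: "test_function \<psi>"
  shows "has_weak_grad \<psi> (grad \<psi>)"
  unfolding has_weak_grad_def
proof (intro conjI allI impI)
  show loc\<psi>: "locally_integrable \<psi>" "locally_integrable (grad \<psi>)"
    using integrable_test_function[OF \<psi>] by (auto intro: locally_integrable_integrable)
  fix \<phi> :: "'a \<Rightarrow> real" assume \<phi>: "test_function \<phi>"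
  have "0 = (LINT x|lebesgue. grad (\<lambda>x. \<psi> x * \<phi> x) x)"
    using integral_grad_test_function[OF test_function_mult(1)[OF \<psi> \<phi>]] by simp
  also have "\<dots> = (LINT x|lebesgue. \<psi> x *\<^sub>R grad \<phi> x) + (LINT x|lebesgue. \<phi> x *\<^sub>R grad \<psi> x)"
    using integrable_test_function_scaleR(1)[OF \<phi> loc\<psi>(1)]
      integrable_test_function_scaleR(2)[OF \<phi> loc\<psi>(2)] by (simp add: test_function_mult(2)[OF \<psi> \<phi>])
  finally show "(LINT x|lebesgue. \<psi> x *\<^sub>R grad \<phi> x) = - (LINT x|lebesgue. \<phi> x *\<^sub>R grad \<psi> x)"
    by (simp add: eq_neg_iff_add_eq_0)
qed

subsection \<open>Energies\<close>

text \<open>Membership in \<open>X_space\<close> with an explicit gradient as witness, so that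
  competitors can be computed with instead of their unspecified \<open>weak_grad\<close>.\<close>

definition finite_energy :: "('a::euclidean_space \<Rightarrow> real) \<Rightarrow> ('a \<Rightarrow> 'a) \<Rightarrow> bool" where
  "finite_energy u g \<longleftrightarrow> has_weak_grad u g \<and> integrable lebesgue (\<lambda>x. \<bar>u x\<bar>\<^sup>2) \<and>
     integrable lebesgue (\<lambda>x. (norm (g x))\<^sup>2) \<and> integrable lebesgue (\<lambda>x. \<bar>u x\<bar>\<^sup>2 * (norm (g x))\<^sup>2)"

definition grad_energy :: "('a::euclidean_space \<Rightarrow> real) \<Rightarrow> ('a \<Rightarrow> 'a) \<Rightarrow> real" where
  "grad_energy u g = 1/2 * (LINT x|lebesgue. (norm (g x))\<^sup>2) + (LINT x|lebesgue. \<bar>u x\<bar>\<^sup>2 * (norm (g x))\<^sup>2)"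

lemma grad_energy_nonneg: "0 \<le> grad_energy u g"
  by (simp add: grad_energy_def)

lemma has_weak_grad_measurable:
  assumes "has_weak_grad u g"
  shows "u \<in> borel_measurable lebesgue" "g \<in> borel_measurable lebesgue"
  using assms by (auto simp: has_weak_grad_def locally_integrable_def)

lemma finite_energy_weak_grad:
  assumes "u \<in> X_space" shows "finite_energy u (weak_grad u)"
proof -
  obtain g where g: "has_weak_grad u g" "integrable lebesgue (\<lambda>x. (norm (g x))\<^sup>2)"
    using assms by (auto simp: X_space_def W12_def)
  have w: "has_weak_grad u (weak_grad u)" using g(1) by (rule has_weak_grad_weak_grad)
  note [measurable] = has_weak_grad_measurable[OF w] has_weak_grad_measurable[OF g(1)]
  have "integrable lebesgue (\<lambda>x. (norm (weak_grad u x))\<^sup>2) \<longleftrightarrow> integrable lebesgue (\<lambda>x. (norm (g x))\<^sup>2)"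
    using has_weak_grad_unique[OF w g(1)] by (intro integrable_cong_AE) (auto elim: eventually_mono)
  with w g assms show ?thesis
    by (auto simp: finite_energy_def X_space_def W12_def)
qed

lemma
  assumes "finite_energy u g"
  shows finite_energy_imp_X_space: "u \<in> X_space"
    and J_eq_grad_energy: "J p u = grad_energy u g - 1 / (p + 1) * (LINT x|lebesgue. \<bar>u x\<bar> powr (p + 1))"
proof -
  have g: "has_weak_grad u g" using assms by (simp add: finite_energy_def)
  have w: "has_weak_grad u (weak_grad u)" using g by (rule has_weak_grad_weak_grad)
  note [measurable] = has_weak_grad_measurable[OF w] has_weak_grad_measurable[OF g]
  note ae = has_weak_grad_unique[OF w g]
  have "integrable lebesgue (\<lambda>x. \<bar>u x\<bar>\<^sup>2 * (norm (weak_grad u x))\<^sup>2)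
      \<longleftrightarrow> integrable lebesgue (\<lambda>x. \<bar>u x\<bar>\<^sup>2 * (norm (g x))\<^sup>2)"
    using ae by (intro integrable_cong_AE) (auto elim: eventually_mono)
  then show "u \<in> X_space"
    using assms by (auto simp: finite_energy_def X_space_def W12_def dest: has_weak_grad_measurable)
  have "(LINT x|lebesgue. \<bar>u x\<bar>\<^sup>2 * (norm (weak_grad u x))\<^sup>2) = (LINT x|lebesgue. \<bar>u x\<bar>\<^sup>2 * (norm (g x))\<^sup>2)"
    "(LINT x|lebesgue. (norm (weak_grad u x))\<^sup>2) = (LINT x|lebesgue. (norm (g x))\<^sup>2)"
    using ae by (auto intro!: integral_cong_AE elim: eventually_mono)
  then show "J p u = grad_energy u g - 1 / (p + 1) * (LINT x|lebesgue. \<bar>u x\<bar> powr (p + 1))"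
    by (simp add: J_def grad_energy_def)
qed

section \<open>Dilation and amplification\<close>

lemma
  fixes f :: "'a::euclidean_space \<Rightarrow> real"
  assumes r: "0 < r" and f: "f \<in> borel_measurable lebesgue"
  shows integrable_dilation_iff: "integrable lebesgue (\<lambda>x. f (inverse r *\<^sub>R x)) \<longleftrightarrow> integrable lebesgue f"
    and integral_dilation: "(LINT x|lebesgue. f (inverse r *\<^sub>R x)) = r ^ DIM('a) * integral\<^sup>L lebesgue f"
  using integrable_lebesgue_affine_iff[of "inverse r" f 0] integral_lebesgue_affine[of "inverse r" f 0] r f
  by (auto simp: power_inverse field_simps)

text \<open>Both gradient terms are quadratic in the gradient and hence scale alike, by
  \<open>r^(N-2)\<close>; this is why they are kept together in \<open>grad_energy\<close>. Mass and
  power term scale by \<open>r^N\<close>.\<close>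

lemma
  fixes u :: "'a::euclidean_space \<Rightarrow> real"
  assumes u: "finite_energy u g" and r: "0 < r"
  defines "w \<equiv> \<lambda>x. u (inverse r *\<^sub>R x)"
  shows dilation_in_S: "w \<in> S (r ^ DIM('a) * (LINT x|lebesgue. \<bar>u x\<bar>\<^sup>2))"
    and J_dilation: "J p w = r ^ DIM('a) *
      (grad_energy u g / r\<^sup>2 - 1 / (p + 1) * (LINT x|lebesgue. \<bar>u x\<bar> powr (p + 1)))"
proof -
  let ?h = "\<lambda>x. inverse r *\<^sub>R g (inverse r *\<^sub>R x)"
  have g: "has_weak_grad u g" using u by (simp add: finite_energy_def)
  note [measurable] = has_weak_grad_measurable[OF g]
  have norm_h: "(norm (?h x))\<^sup>2 = (norm (g (inverse r *\<^sub>R x)))\<^sup>2 / r\<^sup>2" for x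
    using r by (simp add: power_mult_distrib power_inverse field_simps)
  have m: "(\<lambda>x. (u x)\<^sup>2) \<in> borel_measurable lebesgue" "(\<lambda>x. (norm (g x))\<^sup>2) \<in> borel_measurable lebesgue"
    "(\<lambda>x. (u x)\<^sup>2 * (norm (g x))\<^sup>2) \<in> borel_measurable lebesgue" "(\<lambda>x. \<bar>u x\<bar> powr (p + 1)) \<in> borel_measurable lebesgue"
    by measurable
  note scale = integrable_dilation_iff[OF r m(1)] integrable_dilation_iff[OF r m(2)] integrable_dilation_iff[OF r m(3)]
    integral_dilation[OF r m(1)] integral_dilation[OF r m(2)] integral_dilation[OF r m(3)] integral_dilation[OF r m(4)]
  have w: "finite_energy w ?h"
    using u has_weak_grad_dilation[OF g, of "inverse r"] r
    unfolding finite_energy_def norm_h w_def times_divide_eq_right by (simp add: scale)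
  show "w \<in> S (r ^ DIM('a) * (LINT x|lebesgue. \<bar>u x\<bar>\<^sup>2))"
    using finite_energy_imp_X_space[OF w] by (simp add: S_def) (simp add: w_def scale)
  have "grad_energy w ?h = r ^ DIM('a) * (grad_energy u g / r\<^sup>2)"
    unfolding grad_energy_def norm_h w_def times_divide_eq_right
    by (simp add: scale add_divide_distrib algebra_simps)
  then show "J p w = r ^ DIM('a) *
      (grad_energy u g / r\<^sup>2 - 1 / (p + 1) * (LINT x|lebesgue. \<bar>u x\<bar> powr (p + 1)))"
    unfolding J_eq_grad_energy[OF w] by (simp add: w_def scale right_diff_distrib)
qed

lemma finite_energy_cmult:
  assumes "finite_energy u g"
  shows "finite_energy (\<lambda>x. s * u x) (\<lambda>x. s *\<^sub>R g x)"
proof -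
  have "\<bar>s * u x\<bar>\<^sup>2 * (norm (s *\<^sub>R g x))\<^sup>2 = s ^ 4 * (\<bar>u x\<bar>\<^sup>2 * (norm (g x))\<^sup>2)" for x
    by (simp add: power_mult_distrib power2_eq_square power4_eq_xxxx)
  moreover have "\<bar>s * u x\<bar>\<^sup>2 = s\<^sup>2 * \<bar>u x\<bar>\<^sup>2" "(norm (s *\<^sub>R g x))\<^sup>2 = s\<^sup>2 * (norm (g x))\<^sup>2" for x
    by (simp_all add: power_mult_distrib)
  ultimately show ?thesis
    using assms has_weak_grad_cmult[of u g s] unfolding finite_energy_def by (simp only:) simp
qed

lemma finite_energy_test_function:
  assumes "test_function \<phi>"
  shows "finite_energy \<phi> (grad \<phi>)" "0 < q \<Longrightarrow> integrable lebesgue (\<lambda>x. \<bar>\<phi> x\<bar> powr q)"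
proof -
  obtain K B where K: "compact K" "0 \<le> B" "\<And>x. \<bar>\<phi> x\<bar> \<le> B * indicator K x"
    "\<And>x. norm (grad \<phi> x) \<le> B * indicator K x"
    using assms test_functionE by metis
  note [measurable] = test_function_measurable_lebesgue[OF assms]
  have b: "\<bar>\<phi> x\<bar>\<^sup>2 \<le> B\<^sup>2 * indicator K x" "(norm (grad \<phi> x))\<^sup>2 \<le> B\<^sup>2 * indicator K x" for x
    using power_mono[OF K(3), of x 2] power_mono[OF K(4), of x 2] by (auto simp: indicator_def split: if_splits)
  have "\<bar>\<phi> x\<bar>\<^sup>2 * (norm (grad \<phi> x))\<^sup>2 \<le> B ^ 4 * indicator K x" for x
    using mult_mono[OF b, of x x] K(2) by (auto simp: indicator_def power2_eq_square power4_eq_xxxx split: if_splits)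
  with b K(1) show "finite_energy \<phi> (grad \<phi>)"
    using has_weak_grad_test_function[OF assms] unfolding finite_energy_def
    by (auto intro!: integrable_bounded_compact_support[of K])
  show "integrable lebesgue (\<lambda>x. \<bar>\<phi> x\<bar> powr q)" if "0 < q"
  proof (rule integrable_bounded_compact_support[OF K(1)])
    show "norm (\<bar>\<phi> x\<bar> powr q) \<le> B powr q * indicator K x" for x
      using powr_mono2[OF _ _ K(3), of q x] that by (cases "x \<in> K") auto
  qed simp
qed

lemma integral_pos_on_box:
  fixes f :: "'a::euclidean_space \<Rightarrow> real"
  assumes "integrable lebesgue f" "\<And>x. 0 \<le> f x" "\<And>x. x \<in> box a b \<Longrightarrow> 0 < f x" "box a b \<noteq> {}"
  shows "0 < integral\<^sup>L lebesgue f"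
proof (rule ccontr)
  assume "\<not> 0 < integral\<^sup>L lebesgue f"
  then have "integral\<^sup>L lebesgue f = 0"
    using Bochner_Integration.integral_nonneg[of lebesgue f] assms(2) by (simp add: order.antisym)
  then have "AE x in lebesgue. f x = 0"
    using integral_nonneg_eq_0_iff_AE[OF assms(1)] assms(2) by simp
  then have "AE x in lebesgue. x \<notin> box a b"
    by (rule eventually_mono) (use assms(3) in force)
  then have "negligible (box a b)"
    by (simp add: AE_iff_null_sets negligible_iff_null_sets)
  then show False
    using assms(4) by (metis negligible_iff_null_sets non_negligible_UNIV open_box open_not_negligible)
qed

text \<open>For a fixed amplitude \<open>s\<close> the gradient terms become negligible under dilation, and the ratio
  \<open>J / c\<close> tends to a negative multiple of \<open>s powr (p - 1)\<close>.\<close>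

lemma exists_low_energy:
  fixes p Z :: real
  assumes p: "1 < p" and Z: "0 < Z"
  obtains c0 where "0 < c0" "\<And>c. c0 < c \<Longrightarrow> \<exists>u :: 'a::euclidean_space \<Rightarrow> real. u \<in> S c \<and> J p u \<le> - Z * c"
proof -
  let ?N = "DIM('a)"
  define \<phi> where "\<phi> = bump (0 :: 'a) One 1"
  have \<phi>: "test_function \<phi>" unfolding \<phi>_def by (rule test_function_bump) simp
  have box: "box (0 :: 'a) One \<noteq> {}" by (simp add: box_ne_empty)
  have pos: "0 < \<bar>\<phi> x\<bar>" if "x \<in> box 0 One" for x
    using that by (simp add: \<phi>_def bump_eq_0_iff)
  note fin = finite_energy_test_function(1)[OF \<phi>]
  define M D A B where "M = (LINT x|lebesgue. \<bar>\<phi> x\<bar>\<^sup>2)" and "D = (LINT x|lebesgue. \<bar>\<phi> x\<bar> powr (p + 1))"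
    and "A = (LINT x|lebesgue. (norm (grad \<phi> x))\<^sup>2)" and "B = (LINT x|lebesgue. \<bar>\<phi> x\<bar>\<^sup>2 * (norm (grad \<phi> x))\<^sup>2)"
  have "0 < M" unfolding M_def
    by (rule integral_pos_on_box[OF _ _ _ box]) (use fin pos in \<open>auto simp: finite_energy_def\<close>)
  have "0 < D" unfolding D_def
    by (rule integral_pos_on_box[OF _ _ _ box]) (use finite_energy_test_function(2)[OF \<phi>, of "p + 1"] pos p in auto)
  have AB: "0 \<le> A" "0 \<le> B" by (simp_all add: A_def B_def)
  \<comment> \<open>The amplitude is chosen so that the power term of \<open>s * \<phi>\<close>,
    divided by \<open>p + 1\<close>, equals \<open>Z + 1\<close> times its mass
    \<open>s\<^sup>2 * M\<close>. The excess of one mass leaves room for the gradient terms. Solving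
    for \<open>s\<close> uses \<open>1 < p\<close>.\<close>
  define s where "s = ((Z + 1) * M * (p + 1) / D) powr (1 / (p - 1))"
  have s: "0 < s" using \<open>0 < M\<close> \<open>0 < D\<close> p Z by (simp add: s_def)
  have s_powr: "s powr (p + 1) = s\<^sup>2 * ((Z + 1) * M * (p + 1) / D)"
  proof -
    have "s powr (p + 1) = s powr 2 * s powr (p - 1)" by (simp add: add.commute flip: powr_add)
    also have "s powr (p - 1) = (Z + 1) * M * (p + 1) / D"
      using \<open>0 < M\<close> \<open>0 < D\<close> p Z by (simp add: s_def powr_powr)
    finally show ?thesis using s by (simp add: powr_numeral)
  qed
  \<comment> \<open>The gradient energy of \<open>s * \<phi>\<close> divided by
    \<open>s\<^sup>2\<close>.\<close>
  define H where "H = 1/2 * A + s\<^sup>2 * B"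
  have H: "0 \<le> H" using AB by (simp add: H_def)
  let ?u = "\<lambda>x. s * \<phi> x" and ?g = "\<lambda>x. s *\<^sub>R grad \<phi> x"
  have fin_u: "finite_energy ?u ?g" using fin by (rule finite_energy_cmult)
  have mass: "(LINT x|lebesgue. \<bar>?u x\<bar>\<^sup>2) = s\<^sup>2 * M"
    by (simp add: M_def power_mult_distrib)
  have power: "(LINT x|lebesgue. \<bar>?u x\<bar> powr (p + 1)) = s powr (p + 1) * D"
    using s by (simp add: D_def abs_mult powr_mult)
  have energy: "grad_energy ?u ?g = s\<^sup>2 * H"
    by (simp add: grad_energy_def H_def A_def B_def power_mult_distrib algebra_simps
        flip: Bochner_Integration.integral_mult_right_zero)
  show ?thesis
  \<comment> \<open>The threshold is the mass reached at dilation factor \<open>1 + H / M\<close>.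
    Beyond it \<open>r\<close> is at least 1 and at least \<open>H / M\<close>, so
    \<open>H / r\<^sup>2 \<le> M\<close> and the gradient terms use up no more than the reserved
    mass.\<close>
  proof (rule that[of "s\<^sup>2 * M * (1 + H / M) ^ ?N"])
    show "0 < s\<^sup>2 * M * (1 + H / M) ^ ?N"
      using s \<open>0 < M\<close> H by (simp add: add_pos_nonneg)
    fix c assume c: "s\<^sup>2 * M * (1 + H / M) ^ ?N < c"
    then have "0 < c" using \<open>0 < s\<^sup>2 * M * (1 + H / M) ^ ?N\<close> by simp
    define r where "r = root ?N (c / (s\<^sup>2 * M))"
    have r_pow: "r ^ ?N = c / (s\<^sup>2 * M)"
      using \<open>0 < c\<close> s \<open>0 < M\<close> by (simp add: r_def)
    have "(1 + H / M) ^ ?N < r ^ ?N"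
      using c s \<open>0 < M\<close> by (simp add: r_pow field_simps)
    moreover have "0 \<le> r" using \<open>0 < c\<close> s \<open>0 < M\<close> by (simp add: r_def)
    ultimately have r: "1 + H / M < r" by (rule power_less_imp_less_base)
    moreover have "0 \<le> H / M" using H \<open>0 < M\<close> by simp
    ultimately have "0 < r" "1 \<le> r" by linarith+
    have "r \<le> r\<^sup>2" using \<open>1 \<le> r\<close> by (simp add: power2_eq_square)
    then have "H / M \<le> r\<^sup>2" using r by simp
    then have Hr: "H / r\<^sup>2 \<le> M" using \<open>0 < M\<close> \<open>0 < r\<close> by (simp add: field_simps)
    let ?w = "\<lambda>x. ?u (inverse r *\<^sub>R x)"
    have "?w \<in> S (r ^ ?N * (s\<^sup>2 * M))" using dilation_in_S[OF fin_u \<open>0 < r\<close>] by (simp only: mass)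
    moreover have "r ^ ?N * (s\<^sup>2 * M) = c" using s \<open>0 < M\<close> by (simp add: r_pow)
    moreover have "J p ?w = c / M * (H / r\<^sup>2 - (Z + 1) * M)"
    proof -
      have "J p ?w = c / (s\<^sup>2 * M) * (s\<^sup>2 * H / r\<^sup>2 - 1 / (p + 1) * (s\<^sup>2 * ((Z + 1) * M * (p + 1) / D) * D))"
        unfolding J_dilation[OF fin_u \<open>0 < r\<close>] power energy s_powr r_pow ..
      also have "1 / (p + 1) * (s\<^sup>2 * ((Z + 1) * M * (p + 1) / D) * D) = s\<^sup>2 * ((Z + 1) * M)"
        using \<open>0 < D\<close> p by simp
      also have "c / (s\<^sup>2 * M) * (s\<^sup>2 * H / r\<^sup>2 - s\<^sup>2 * ((Z + 1) * M)) = c / (s\<^sup>2 * M) * (s\<^sup>2 * (H / r\<^sup>2 - (Z + 1) * M))"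
        by (simp add: right_diff_distrib)
      also have "\<dots> = c / M * (H / r\<^sup>2 - (Z + 1) * M)"
        using s by simp
      finally show ?thesis .
    qed
    moreover have "c / M * (H / r\<^sup>2 - (Z + 1) * M) \<le> c / M * (M - (Z + 1) * M)"
      using Hr \<open>0 < c\<close> \<open>0 < M\<close> by (intro mult_left_mono) auto
    moreover have "c / M * (M - (Z + 1) * M) = - Z * c"
      using \<open>0 < M\<close> by (simp add: field_simps)
    ultimately show "\<exists>u :: 'a \<Rightarrow> real. u \<in> S c \<and> J p u \<le> - Z * c" by auto
  qed
qed

subsection \<open>Variation of a minimizer\<close>

text \<open>One majorant serves all cross terms of the expanded energy. A factor
  \<open>\<phi>\<close> or \<open>grad \<phi>\<close> confines the term to a compact set and is
  bounded there; the remaining powers are at most 2, and \<open>y ^ n \<le> 1 + y\<^sup>2\<close>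
  bounds them by \<open>(1 + \<bar>v\<bar>\<^sup>2) * (1 + (norm g)\<^sup>2)\<close>. Multiplied
  out, this is integrable on the compact set exactly by finite energy.\<close>

lemma integrable_energy_term:
  fixes h :: "'a::euclidean_space \<Rightarrow> real"
  assumes fin: "finite_energy v g" and \<phi>: "test_function \<phi>" and h: "h \<in> borel_measurable lebesgue"
    and bound: "\<And>x. \<bar>h x\<bar> \<le> \<bar>v x\<bar> ^ i * norm (g x) ^ k * (\<bar>\<phi> x\<bar> ^ j * norm (grad \<phi> x) ^ l)"
    and "i \<le> 2" "k \<le> 2" "0 < j + l"
  shows "integrable lebesgue h"
proof -
  obtain K B where K: "compact K" "0 \<le> B" "\<And>x. \<bar>\<phi> x\<bar> \<le> B * indicator K x"
    "\<And>x. norm (grad \<phi> x) \<le> B * indicator K x"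
    using \<phi> test_functionE by metis
  have pow: "y ^ n \<le> 1 + y\<^sup>2" if "0 \<le> y" "n \<le> 2" for y :: real and n
  proof -
    consider "n = 0" | "n = 1" | "n = 2" using \<open>n \<le> 2\<close> by linarith
    then show ?thesis
    proof cases
      case 2
      have "0 \<le> (y - 1)\<^sup>2" by simp
      then have "2 * y \<le> 1 + y\<^sup>2" by (simp add: power2_diff)
      then show ?thesis using 2 that by simp
    qed auto
  qed
  show ?thesis
  proof (rule Bochner_Integration.integrable_bound[OF _ h])
    have "integrable lebesgue (indicator K :: 'a \<Rightarrow> real)"
      using K(1) by (intro integrable_bounded_compact_support[of K _ 1]) (auto intro!: borel_measurable_indicator dest: compact_imp_closed)
    then show "integrable lebesgue (\<lambda>x. B ^ (j + l) * (indicator K x + \<bar>v x\<bar>\<^sup>2 + (norm (g x))\<^sup>2 + \<bar>v x\<bar>\<^sup>2 * (norm (g x))\<^sup>2))"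
      using fin unfolding finite_energy_def
      by (intro integrable_mult_right Bochner_Integration.integrable_add) auto
    show "AE x in lebesgue. norm (h x) \<le> norm (B ^ (j + l) * (indicator K x + \<bar>v x\<bar>\<^sup>2 + (norm (g x))\<^sup>2 + \<bar>v x\<bar>\<^sup>2 * (norm (g x))\<^sup>2))"
    proof (rule AE_I2)
      fix x
      have rhs: "0 \<le> B ^ (j + l) * (indicator K x + \<bar>v x\<bar>\<^sup>2 + (norm (g x))\<^sup>2 + \<bar>v x\<bar>\<^sup>2 * (norm (g x))\<^sup>2)"
        using K(2) by simp
      show "norm (h x) \<le> norm (B ^ (j + l) * (indicator K x + \<bar>v x\<bar>\<^sup>2 + (norm (g x))\<^sup>2 + \<bar>v x\<bar>\<^sup>2 * (norm (g x))\<^sup>2))"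
      proof (cases "x \<in> K")
        case True
        have "\<bar>v x\<bar> ^ i * norm (g x) ^ k \<le> (1 + \<bar>v x\<bar>\<^sup>2) * (1 + (norm (g x))\<^sup>2)"
          using assms by (intro mult_mono pow) auto
        moreover have "\<bar>\<phi> x\<bar> ^ j * norm (grad \<phi> x) ^ l \<le> B ^ j * B ^ l"
          using K(2) K(3)[of x] K(4)[of x] True by (intro mult_mono power_mono) auto
        ultimately have "\<bar>v x\<bar> ^ i * norm (g x) ^ k * (\<bar>\<phi> x\<bar> ^ j * norm (grad \<phi> x) ^ l)
            \<le> (1 + \<bar>v x\<bar>\<^sup>2) * (1 + (norm (g x))\<^sup>2) * (B ^ j * B ^ l)"
          by (rule mult_mono) auto
        also have "\<dots> = B ^ (j + l) * (indicator K x + \<bar>v x\<bar>\<^sup>2 + (norm (g x))\<^sup>2 + \<bar>v x\<bar>\<^sup>2 * (norm (g x))\<^sup>2)"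
          using True by (simp add: power_add algebra_simps)
        finally show ?thesis
          using bound[of x] rhs unfolding real_norm_def abs_of_nonneg[OF rhs] by linarith
      next
        case False
        then have "\<phi> x = 0" "grad \<phi> x = 0" using K(3)[of x] K(4)[of x] by auto
        then have "h x = 0" using bound[of x] \<open>0 < j + l\<close> by (auto simp: power_0_left split: if_splits)
        then show ?thesis using rhs by simp
      qed
    qed
  qed
qed

text \<open>The gradient energy is a polynomial of degree at most 4 in \<open>t\<close>, so no
  differentiation under the integral occurs. Its linear coefficient is the gradient part of the weak
  equation; of the higher coefficients only independence of \<open>t\<close> matters.\<close>

lemma finite_energy_perturbation:
  fixes v :: "'a::euclidean_space \<Rightarrow> real"
  assumes fin: "finite_energy v g" and \<phi>: "test_function \<phi>"
  shows "finite_energy (\<lambda>x. v x + t * \<phi> x) (\<lambda>x. g x + t *\<^sub>R grad \<phi> x)"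
    and "(LINT x|lebesgue. \<bar>v x + t * \<phi> x\<bar>\<^sup>2) = (LINT x|lebesgue. \<bar>v x\<bar>\<^sup>2)
      + 2 * t * (LINT x|lebesgue. v x * \<phi> x) + t\<^sup>2 * (LINT x|lebesgue. (\<phi> x)\<^sup>2)"
    and "\<exists>e2 e3 e4. \<forall>t. grad_energy (\<lambda>x. v x + t * \<phi> x) (\<lambda>x. g x + t *\<^sub>R grad \<phi> x) = grad_energy v g
      + t * ((LINT x|lebesgue. g x \<bullet> grad \<phi> x)
           + 2 * (LINT x|lebesgue. v x * \<phi> x * (norm (g x))\<^sup>2 + \<bar>v x\<bar>\<^sup>2 * (g x \<bullet> grad \<phi> x)))
      + t\<^sup>2 * e2 + t ^ 3 * e3 + t ^ 4 * e4"
proof -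
  have wg: "has_weak_grad v g" using fin by (simp add: finite_energy_def)
  note [measurable] = has_weak_grad_measurable[OF wg] test_function_measurable_lebesgue[OF \<phi>]
  note int = integrable_energy_term[OF fin \<phi>]
  let ?G = "grad \<phi>"
  have inner: "\<bar>g x \<bullet> ?G x\<bar> \<le> norm (g x) * norm (?G x)" for x
    by (rule Cauchy_Schwarz_ineq2)
  note CS = mult_left_mono[OF inner]
  have i1: "integrable lebesgue (\<lambda>x. v x * \<phi> x)"
    by (rule int[of _ 1 0 1 0]) (auto simp: abs_mult)
  have i2: "integrable lebesgue (\<lambda>x. (\<phi> x)\<^sup>2)"
    by (rule int[of _ 0 0 2 0]) auto
  have j1: "integrable lebesgue (\<lambda>x. g x \<bullet> ?G x)"
    by (rule int[of _ 0 1 0 1]) (auto simp: inner)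
  have j2: "integrable lebesgue (\<lambda>x. (norm (?G x))\<^sup>2)"
    by (rule int[of _ 0 0 0 2]) auto
  have k1: "integrable lebesgue (\<lambda>x. v x * \<phi> x * (norm (g x))\<^sup>2)"
    by (rule int[of _ 1 2 1 0]) (auto simp: abs_mult)
  have k2: "integrable lebesgue (\<lambda>x. (v x)\<^sup>2 * (g x \<bullet> ?G x))"
    by (rule int[of _ 2 1 0 1]) (use CS[of "(v _)\<^sup>2"] in \<open>auto simp: abs_mult mult_ac\<close>)
  have k3: "integrable lebesgue (\<lambda>x. (v x)\<^sup>2 * (norm (?G x))\<^sup>2)"
    by (rule int[of _ 2 0 0 2]) auto
  have k4: "integrable lebesgue (\<lambda>x. v x * \<phi> x * (g x \<bullet> ?G x))"
    by (rule int[of _ 1 1 1 1]) (use CS[of "\<bar>v _\<bar> * \<bar>\<phi> _\<bar>"] in \<open>auto simp: abs_mult mult_ac\<close>)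
  have k5: "integrable lebesgue (\<lambda>x. (\<phi> x)\<^sup>2 * (norm (g x))\<^sup>2)"
    by (rule int[of _ 0 2 2 0]) (auto simp: mult_ac)
  have k6: "integrable lebesgue (\<lambda>x. v x * \<phi> x * (norm (?G x))\<^sup>2)"
    by (rule int[of _ 1 0 1 2]) (auto simp: abs_mult)
  have k7: "integrable lebesgue (\<lambda>x. (\<phi> x)\<^sup>2 * (g x \<bullet> ?G x))"
    by (rule int[of _ 0 1 2 1]) (use CS[of "(\<phi> _)\<^sup>2"] in \<open>auto simp: abs_mult mult_ac\<close>)
  have k8: "integrable lebesgue (\<lambda>x. (\<phi> x)\<^sup>2 * (norm (?G x))\<^sup>2)"
    by (rule int[of _ 0 0 2 2]) auto
  have v2: "integrable lebesgue (\<lambda>x. (v x)\<^sup>2)" and g2: "integrable lebesgue (\<lambda>x. (norm (g x))\<^sup>2)"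
    and vg: "integrable lebesgue (\<lambda>x. (v x)\<^sup>2 * (norm (g x))\<^sup>2)"
    using fin by (simp_all add: finite_energy_def)
  have sq: "\<bar>v x + t * \<phi> x\<bar>\<^sup>2 = (v x)\<^sup>2 + (2 * t) * (v x * \<phi> x) + t\<^sup>2 * (\<phi> x)\<^sup>2" for t x
    by (simp add: power2_eq_square algebra_simps)
  have gsq: "(norm (g x + t *\<^sub>R ?G x))\<^sup>2 = (norm (g x))\<^sup>2 + (2 * t) * (g x \<bullet> ?G x) + t\<^sup>2 * (norm (?G x))\<^sup>2" for t x
    unfolding power2_norm_eq_inner by (simp add: inner_simps inner_commute power2_eq_square algebra_simps)
  have prod: "\<bar>v x + t * \<phi> x\<bar>\<^sup>2 * (norm (g x + t *\<^sub>R ?G x))\<^sup>2 = (v x)\<^sup>2 * (norm (g x))\<^sup>2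
      + (2 * t) * (v x * \<phi> x * (norm (g x))\<^sup>2 + (v x)\<^sup>2 * (g x \<bullet> ?G x))
      + t\<^sup>2 * ((v x)\<^sup>2 * (norm (?G x))\<^sup>2 + 4 * (v x * \<phi> x * (g x \<bullet> ?G x)) + (\<phi> x)\<^sup>2 * (norm (g x))\<^sup>2)
      + t ^ 3 * (2 * (v x * \<phi> x * (norm (?G x))\<^sup>2) + 2 * ((\<phi> x)\<^sup>2 * (g x \<bullet> ?G x)))
      + t ^ 4 * ((\<phi> x)\<^sup>2 * (norm (?G x))\<^sup>2)" for t x
    unfolding sq gsq by (simp add: power2_eq_square power3_eq_cube power4_eq_xxxx algebra_simps)
  have "has_weak_grad (\<lambda>x. v x + t * \<phi> x) (\<lambda>x. g x + t *\<^sub>R ?G x)" for t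
    by (intro has_weak_grad_add has_weak_grad_cmult has_weak_grad_test_function wg \<phi>)
  then show "finite_energy (\<lambda>x. v x + t * \<phi> x) (\<lambda>x. g x + t *\<^sub>R ?G x)"
    unfolding finite_energy_def prod unfolding sq gsq
    by (intro conjI Bochner_Integration.integrable_add integrable_mult_right
        i1 i2 j1 j2 k1 k2 k3 k4 k5 k6 k7 k8 v2 g2 vg)
  show "(LINT x|lebesgue. \<bar>v x + t * \<phi> x\<bar>\<^sup>2) = (LINT x|lebesgue. \<bar>v x\<bar>\<^sup>2)
      + 2 * t * (LINT x|lebesgue. v x * \<phi> x) + t\<^sup>2 * (LINT x|lebesgue. (\<phi> x)\<^sup>2)"
    unfolding sq using i1 i2 v2 by simp
  have gint: "(LINT x|lebesgue. (norm (g x + t *\<^sub>R ?G x))\<^sup>2) = (LINT x|lebesgue. (norm (g x))\<^sup>2)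
      + (2 * t) * (LINT x|lebesgue. g x \<bullet> ?G x) + t\<^sup>2 * (LINT x|lebesgue. (norm (?G x))\<^sup>2)" for t
    unfolding gsq using j1 j2 g2 by simp
  define q1 q2 q3 q4 where "q1 x = v x * \<phi> x * (norm (g x))\<^sup>2 + (v x)\<^sup>2 * (g x \<bullet> ?G x)"
    and "q2 x = (v x)\<^sup>2 * (norm (?G x))\<^sup>2 + 4 * (v x * \<phi> x * (g x \<bullet> ?G x)) + (\<phi> x)\<^sup>2 * (norm (g x))\<^sup>2"
    and "q3 x = 2 * (v x * \<phi> x * (norm (?G x))\<^sup>2) + 2 * ((\<phi> x)\<^sup>2 * (g x \<bullet> ?G x))"
    and "q4 x = (\<phi> x)\<^sup>2 * (norm (?G x))\<^sup>2" for x
  have q: "integrable lebesgue q1" "integrable lebesgue q2" "integrable lebesgue q3" "integrable lebesgue q4"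
    unfolding q1_def q2_def q3_def q4_def
    by (intro Bochner_Integration.integrable_add integrable_mult_right k1 k2 k3 k4 k5 k6 k7 k8)+
  have vgint: "(LINT x|lebesgue. \<bar>v x + t * \<phi> x\<bar>\<^sup>2 * (norm (g x + t *\<^sub>R ?G x))\<^sup>2)
      = (LINT x|lebesgue. (v x)\<^sup>2 * (norm (g x))\<^sup>2) + (2 * t) * integral\<^sup>L lebesgue q1
      + t\<^sup>2 * integral\<^sup>L lebesgue q2 + t ^ 3 * integral\<^sup>L lebesgue q3 + t ^ 4 * integral\<^sup>L lebesgue q4" for t
    unfolding prod q1_def[symmetric] q2_def[symmetric] q3_def[symmetric] q4_def[symmetric]
    using q vg by simp
  show "\<exists>e2 e3 e4. \<forall>t. grad_energy (\<lambda>x. v x + t * \<phi> x) (\<lambda>x. g x + t *\<^sub>R ?G x) = grad_energy v g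
      + t * ((LINT x|lebesgue. g x \<bullet> ?G x)
           + 2 * (LINT x|lebesgue. v x * \<phi> x * (norm (g x))\<^sup>2 + \<bar>v x\<bar>\<^sup>2 * (g x \<bullet> ?G x)))
      + t\<^sup>2 * e2 + t ^ 3 * e3 + t ^ 4 * e4"
    unfolding grad_energy_def gint vgint unfolding power2_abs q1_def[symmetric]
    by (rule exI[of _ "1/2 * (LINT x|lebesgue. (norm (?G x))\<^sup>2) + integral\<^sup>L lebesgue q2"],
        rule exI[of _ "integral\<^sup>L lebesgue q3"], rule exI[of _ "integral\<^sup>L lebesgue q4"])
      (simp add: algebra_simps)
qed

text \<open>Convexity in tangent form, obtained from Young's inequality for
  \<open>\<bar>a\<bar> powr (q - 1)\<close> and \<open>\<bar>a + b\<bar>\<close> with the conjugate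
  exponents \<open>q / (q - 1)\<close> and \<open>q\<close>.\<close>

lemma powr_tangent_le:
  fixes a b q :: real
  assumes "1 < q"
  shows "\<bar>a\<bar> powr q + q * (\<bar>a\<bar> powr (q - 2) * a * b) \<le> \<bar>a + b\<bar> powr q"
proof (cases "a = 0")
  case False
  have split: "\<bar>a\<bar> powr q = \<bar>a\<bar> powr (q - 2) * a * a"
    using False powr_add[of "\<bar>a\<bar>" "q - 2" 2] by (simp add: powr_numeral power2_eq_square mult.assoc)
  have "\<bar>a\<bar> powr (q - 2) * a * (a + b) \<le> \<bar>a\<bar> powr (q - 2) * (\<bar>a\<bar> * \<bar>a + b\<bar>)"
    unfolding mult.assoc by (intro mult_left_mono) (auto simp: abs_mult[symmetric])
  also have "\<dots> = \<bar>a\<bar> powr (q - 1) * \<bar>a + b\<bar>"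
    using False powr_add[of "\<bar>a\<bar>" "q - 2" 1] by simp
  also have "\<dots> \<le> (\<bar>a\<bar> powr (q - 1)) powr (q / (q - 1)) / (q / (q - 1)) + \<bar>a + b\<bar> powr q / q"
    using assms by (intro Youngs_inequality) (auto simp: field_simps)
  also have "(\<bar>a\<bar> powr (q - 1)) powr (q / (q - 1)) = \<bar>a\<bar> powr q"
    using assms by (simp add: powr_powr)
  finally have "q * (\<bar>a\<bar> powr (q - 2) * a * (a + b)) \<le> (q - 1) * \<bar>a\<bar> powr q + \<bar>a + b\<bar> powr q"
    using assms by (simp add: field_simps)
  then show ?thesis
    unfolding split by (simp add: algebra_simps)
qed simp

text \<open>The pointwise tangent inequality is integrated; the work lies in integrability. The
  linear term is dominated through
  \<open>\<bar>v\<bar> powr (q - 1) \<le> 1 + \<bar>v\<bar> powr q\<close> on the support of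
  \<open>\<phi>\<close>. With \<open>q = p + 1\<close> it is the power term of the weak
  equation.\<close>

lemma power_perturbation:
  fixes v \<phi> :: "'a::euclidean_space \<Rightarrow> real"
  assumes q: "2 < q" and v: "integrable lebesgue (\<lambda>x. \<bar>v x\<bar> powr q)" "v \<in> borel_measurable lebesgue"
    and \<phi>: "test_function \<phi>"
  shows "(LINT x|lebesgue. \<bar>v x\<bar> powr q) + q * t * (LINT x|lebesgue. \<bar>v x\<bar> powr (q - 2) * v x * \<phi> x)
    \<le> (LINT x|lebesgue. \<bar>v x + t * \<phi> x\<bar> powr q)"
proof -
  obtain K B where K: "compact K" "0 \<le> B" "\<And>x. \<bar>\<phi> x\<bar> \<le> B * indicator K x"
    using \<phi> test_functionE by metis
  note [measurable] = v(2) test_function_measurable_lebesgue[OF \<phi>]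
  have I: "integrable lebesgue (indicator K :: 'a \<Rightarrow> real)"
    using K(1) by (intro integrable_bounded_compact_support[of K _ 1]) (auto intro!: borel_measurable_indicator dest: compact_imp_closed)
  have int1: "integrable lebesgue (\<lambda>x. \<bar>v x\<bar> powr (q - 2) * v x * \<phi> x)"
  proof (rule Bochner_Integration.integrable_bound)
    show "integrable lebesgue (\<lambda>x. B * (indicator K x + \<bar>v x\<bar> powr q))"
      using I v(1) by (intro integrable_mult_right Bochner_Integration.integrable_add)
    show "AE x in lebesgue. norm (\<bar>v x\<bar> powr (q - 2) * v x * \<phi> x) \<le> norm (B * (indicator K x + \<bar>v x\<bar> powr q))"
    proof (rule AE_I2)
      fix x
      have eq: "\<bar>v x\<bar> powr (q - 2) * \<bar>v x\<bar> = \<bar>v x\<bar> powr (q - 1)"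
        using powr_add[of "\<bar>v x\<bar>" "q - 2" 1] q by (cases "v x = 0") auto
      have le: "\<bar>v x\<bar> powr (q - 1) \<le> 1 + \<bar>v x\<bar> powr q"
      proof (cases "\<bar>v x\<bar> \<le> 1")
        case True
        then have "\<bar>v x\<bar> powr (q - 1) \<le> 1" using q by (intro powr_le1) auto
        then show ?thesis by (simp add: add_increasing2)
      next
        case False
        then have "\<bar>v x\<bar> powr (q - 1) \<le> \<bar>v x\<bar> powr q" by (intro powr_mono) auto
        then show ?thesis by simp
      qed
      have "\<bar>v x\<bar> powr (q - 1) * \<bar>\<phi> x\<bar> \<le> (1 + \<bar>v x\<bar> powr q) * (B * indicator K x)"
        using le K(3) by (intro mult_mono) auto
      also have "\<dots> \<le> B * (indicator K x + \<bar>v x\<bar> powr q)"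
        using K(2) by (auto simp: indicator_def algebra_simps)
      finally show "norm (\<bar>v x\<bar> powr (q - 2) * v x * \<phi> x) \<le> norm (B * (indicator K x + \<bar>v x\<bar> powr q))"
        using K(2) by (simp add: abs_mult eq)
    qed
  qed measurable
  have int2: "integrable lebesgue (\<lambda>x. \<bar>v x + t * \<phi> x\<bar> powr q)"
  proof (rule Bochner_Integration.integrable_bound)
    show "integrable lebesgue (\<lambda>x. 2 powr q * (\<bar>v x\<bar> powr q + \<bar>t\<bar> powr q * \<bar>\<phi> x\<bar> powr q))"
      using v(1) finite_energy_test_function(2)[OF \<phi>, of q] q
      by (intro integrable_mult_right Bochner_Integration.integrable_add) auto
    show "AE x in lebesgue. norm (\<bar>v x + t * \<phi> x\<bar> powr q)
        \<le> norm (2 powr q * (\<bar>v x\<bar> powr q + \<bar>t\<bar> powr q * \<bar>\<phi> x\<bar> powr q))"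
    proof (rule AE_I2)
      fix x
      have "\<bar>v x + t * \<phi> x\<bar> powr q \<le> (2 * max \<bar>v x\<bar> \<bar>t * \<phi> x\<bar>) powr q"
        using q by (intro powr_mono2) auto
      also have "\<dots> = 2 powr q * max \<bar>v x\<bar> \<bar>t * \<phi> x\<bar> powr q"
        by (simp add: powr_mult)
      also have "\<dots> \<le> 2 powr q * (\<bar>v x\<bar> powr q + \<bar>t * \<phi> x\<bar> powr q)"
        by (intro mult_left_mono) (auto simp: max_def)
      finally show "norm (\<bar>v x + t * \<phi> x\<bar> powr q) \<le> norm (2 powr q * (\<bar>v x\<bar> powr q + \<bar>t\<bar> powr q * \<bar>\<phi> x\<bar> powr q))"
        by (simp add: abs_mult powr_mult)
    qed
  qed measurable
  have "(LINT x|lebesgue. \<bar>v x\<bar> powr q) + q * t * (LINT x|lebesgue. \<bar>v x\<bar> powr (q - 2) * v x * \<phi> x)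
      = (LINT x|lebesgue. \<bar>v x\<bar> powr q + q * t * (\<bar>v x\<bar> powr (q - 2) * v x * \<phi> x))"
    using v int1 by simp
  also have "\<dots> \<le> (LINT x|lebesgue. \<bar>v x + t * \<phi> x\<bar> powr q)"
  proof (rule integral_mono)
    show "integrable lebesgue (\<lambda>x. \<bar>v x\<bar> powr q + q * t * (\<bar>v x\<bar> powr (q - 2) * v x * \<phi> x))"
      using v int1 by simp
    show "\<bar>v x\<bar> powr q + q * t * (\<bar>v x\<bar> powr (q - 2) * v x * \<phi> x) \<le> \<bar>v x + t * \<phi> x\<bar> powr q" for x
      using powr_tangent_le[of q "v x" "t * \<phi> x"] q by (simp add: mult_ac)
  qed (rule int2)
  finally show ?thesis .
qed

lemma minimizer_multiplier_le:
  fixes v :: "'a::euclidean_space \<Rightarrow> real"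
  assumes p: "1 < p" and c: "0 < c" and v: "v \<in> S c" and sol: "weak_solution p \<beta> v"
    and int: "integrable lebesgue (\<lambda>x. \<bar>v x\<bar> powr (p + 1))"
    and min: "\<And>u :: 'a \<Rightarrow> real. u \<in> S c \<Longrightarrow> J p v \<le> J p u"
  shows "\<beta> * c \<le> 2 * J p v"
proof -
  let ?g = "weak_grad v" and ?N = "DIM('a)"
  have fin: "finite_energy v ?g"
    using v finite_energy_weak_grad by (auto simp: S_def)
  have mass: "(LINT x|lebesgue. \<bar>v x\<bar>\<^sup>2) = c" using v by (simp add: S_def)
  have wg: "has_weak_grad v ?g" using fin by (simp add: finite_energy_def)
  note [measurable] = has_weak_grad_measurable[OF wg]
  \<comment> \<open>If every test function were orthogonal to \<open>v\<close>, then
    \<open>v\<close> would vanish almost everywhere, against its positive mass.\<close>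
  obtain \<phi> :: "'a \<Rightarrow> real" where \<phi>: "test_function \<phi>" and nz: "(LINT x|lebesgue. \<phi> x *\<^sub>R v x) \<noteq> 0"
  proof (rule ccontr)
    assume "\<not> thesis"
    then have "AE x in lebesgue. v x = 0"
      using that wg by (intro locally_integrable_test_function_zero_imp_AE_zero) (auto simp: has_weak_grad_def)
    then have "(LINT x|lebesgue. \<bar>v x\<bar>\<^sup>2) = 0"
      by (intro integral_eq_zero_AE) (auto elim: eventually_mono)
    then show False using c mass by simp
  qed
  define a b where "a = (LINT x|lebesgue. v x * \<phi> x)" and "b = (LINT x|lebesgue. (\<phi> x)\<^sup>2)"
  have "a \<noteq> 0" using nz by (simp add: a_def mult.commute)
  define G0 H1 where "G0 = grad_energy v ?g" and "H1 = (LINT x|lebesgue. ?g x \<bullet> grad \<phi> x)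
    + 2 * (LINT x|lebesgue. v x * \<phi> x * (norm (?g x))\<^sup>2 + \<bar>v x\<bar>\<^sup>2 * (?g x \<bullet> grad \<phi> x))"
  define D E where "D = (LINT x|lebesgue. \<bar>v x\<bar> powr (p + 1))"
    and "E = (LINT x|lebesgue. \<bar>v x\<bar> powr (p - 1) * v x * \<phi> x)"
  have eq: "H1 - \<beta> * a - E = 0"
    using sol \<phi> by (simp add: weak_solution_def H1_def a_def E_def)
  define u where "u t x = v x + t * \<phi> x" for t x
  define h where "h t x = ?g x + t *\<^sub>R grad \<phi> x" for t x
  have fin_u: "finite_energy (u t) (h t)" for t
    unfolding u_def[abs_def] h_def[abs_def] by (rule finite_energy_perturbation(1)[OF fin \<phi>])
  define M where "M t = c + 2 * t * a + t\<^sup>2 * b" for t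
  have mass_u: "(LINT x|lebesgue. \<bar>u t x\<bar>\<^sup>2) = M t" for t
    unfolding u_def M_def a_def b_def finite_energy_perturbation(2)[OF fin \<phi>] mass ..
  have "\<exists>e2 e3 e4. \<forall>t. grad_energy (u t) (h t) = G0 + t * H1 + t\<^sup>2 * e2 + t ^ 3 * e3 + t ^ 4 * e4"
    unfolding u_def[abs_def] h_def[abs_def] G0_def H1_def
    by (rule finite_energy_perturbation(3)[OF fin \<phi>])
  then obtain e2 e3 e4 where energy_u:
    "\<And>t. grad_energy (u t) (h t) = G0 + t * H1 + t\<^sup>2 * e2 + t ^ 3 * e3 + t ^ 4 * e4"
    by blast
  define Q where "Q t = G0 + t * H1 + t\<^sup>2 * e2 + t ^ 3 * e3 + t ^ 4 * e4" for t
  have power_u: "D + (p + 1) * t * E \<le> (LINT x|lebesgue. \<bar>u t x\<bar> powr (p + 1))" for t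
    using power_perturbation[of "p + 1" v \<phi> t] p int \<phi> by (simp add: u_def D_def E_def)
  \<comment> \<open>\<open>F t\<close> bounds from above the energy of \<open>u t\<close> dilated back to mass \<open>c\<close>, with equality at \<open>t = 0\<close>.\<close>
  define F where "F t = c / M t * (Q t * (c / M t) powr (- 2 / real ?N) - (D / (p + 1) + t * E))" for t
  have J_v: "J p v = G0 - D / (p + 1)"
    unfolding J_eq_grad_energy[OF fin] by (simp add: G0_def D_def)
  have F_ge: "J p v \<le> F t" if "0 < M t" for t
  proof -
    define r where "r = root ?N (c / M t)"
    have r: "0 < r" using c that by (simp add: r_def)
    have r_pow: "r ^ ?N = c / M t" using c that by (simp add: r_def)
    have "r powr real ?N = c / M t" using r r_pow by (simp add: powr_realpow)
    \<comment> \<open>\<open>F\<close> is written with powers of \<open>c / M t\<close>, so that no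
      root has to be differentiated; this recovers the factor \<open>1 / r\<^sup>2\<close> of the
      dilation formula.\<close>
    then have "(c / M t) powr (- 2 / real ?N) = r powr (- 2)"
      using powr_powr[of r "real ?N" "- 2 / real ?N"] by simp
    then have r2: "(c / M t) powr (- 2 / real ?N) = 1 / r\<^sup>2"
      using r by (simp add: powr_minus powr_numeral field_simps)
    have "(\<lambda>x. u t (inverse r *\<^sub>R x)) \<in> S c"
      using dilation_in_S[OF fin_u r, of t] that unfolding mass_u r_pow by simp
    then have "J p v \<le> J p (\<lambda>x. u t (inverse r *\<^sub>R x))" by (rule min)
    also have "\<dots> = c / M t * (Q t / r\<^sup>2 - 1 / (p + 1) * (LINT x|lebesgue. \<bar>u t x\<bar> powr (p + 1)))"
      unfolding J_dilation[OF fin_u r] r_pow energy_u Q_def ..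
    also have "\<dots> \<le> c / M t * (Q t / r\<^sup>2 - 1 / (p + 1) * (D + (p + 1) * t * E))"
      using power_u[of t] c that p by (intro mult_left_mono diff_left_mono) auto
    also have "\<dots> = F t"
      unfolding F_def r2 using p by (simp add: field_simps)
    finally show ?thesis .
  qed
  have "M 0 = c" by (simp add: M_def)
  have F0: "F 0 = J p v" using c by (simp add: F_def \<open>M 0 = c\<close> Q_def J_v)
  have dM: "(M has_real_derivative 2 * a) (at 0)"
    unfolding M_def by (auto intro!: derivative_eq_intros)
  have dQ: "(Q has_real_derivative H1) (at 0)"
    unfolding Q_def by (auto intro!: derivative_eq_intros)
  have dcM: "((\<lambda>t. c / M t) has_real_derivative - 2 * a / c) (at 0)"
    using c \<open>M 0 = c\<close> by (auto intro!: derivative_eq_intros dM simp: field_simps)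
  have "((\<lambda>t. (c / M t) powr (- 2 / real ?N)) has_real_derivative
      - 2 / real ?N * (c / M 0) powr (- 2 / real ?N - 1) * (- 2 * a / c)) (at 0)"
    using c \<open>M 0 = c\<close> by (intro DERIV_chain2[OF has_real_derivative_powr dcM]) auto
  then have dpow: "((\<lambda>t. (c / M t) powr (- 2 / real ?N)) has_real_derivative 4 * a / (real ?N * c)) (at 0)"
    using c by (simp add: \<open>M 0 = c\<close>)
  have "((\<lambda>t. Q t * (c / M t) powr (- 2 / real ?N) - (D / (p + 1) + t * E)) has_real_derivative
      H1 + G0 * (4 * a / (real ?N * c)) - E) (at 0)"
    using c by (auto intro!: derivative_eq_intros dQ dM simp: \<open>M 0 = c\<close> Q_def field_simps)
  \<comment> \<open>The bracket in \<open>F\<close> equals \<open>J p v\<close> at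
    \<open>t = 0\<close>, so the derivative of the prefactor contributes a multiple of the whole
    energy.\<close>
  from DERIV_mult[OF dcM this] have dF: "(F has_real_derivative
      - 2 * a / c * J p v + (H1 + G0 * (4 * a / (real ?N * c)) - E)) (at 0)"
    unfolding F_def[abs_def] using c by (simp add: \<open>M 0 = c\<close> Q_def J_v algebra_simps)
  have "isCont M 0" using dM by (rule DERIV_isCont)
  then have "\<forall>\<^sub>F t in at 0. 0 < M t"
    using c \<open>M 0 = c\<close> by (intro order_tendstoD(1)[of M "M 0"]) (auto simp: isCont_def)
  then obtain \<delta> where \<delta>: "0 < \<delta>" "\<And>t. t \<noteq> 0 \<Longrightarrow> \<bar>t\<bar> < \<delta> \<Longrightarrow> 0 < M t"
    by (auto simp: eventually_at dist_real_def)
  have "F 0 \<le> F t" if "\<bar>0 - t\<bar> < \<delta>" for t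
    using F_ge[of t] F0 \<delta>(2)[of t] that by (cases "t = 0") auto
  then have "- 2 * a / c * J p v + (H1 + G0 * (4 * a / (real ?N * c)) - E) = 0"
    using DERIV_local_min[OF dF \<delta>(1)] by blast
  \<comment> \<open>The weak equation replaces \<open>H1 - E\<close> by \<open>\<beta> * a\<close>.
    Every term is now a multiple of \<open>a\<close>, and the auxiliary direction cancels.\<close>
  then have "\<beta> * a = a * (2 / c * J p v - 4 * G0 / (real ?N * c))"
    using eq by (simp add: algebra_simps)
  then have "\<beta> = 2 / c * J p v - 4 * G0 / (real ?N * c)"
    using \<open>a \<noteq> 0\<close> by simp
  then have "\<beta> * c = 2 * J p v - 4 * G0 / real ?N"
    using c by (simp add: field_simps)
  moreover have "0 \<le> G0" by (simp add: G0_def grad_energy_nonneg)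
  ultimately show ?thesis by simp
qed

theorem lemma1p2:
  fixes p :: real
    and v :: "real \<Rightarrow> real ^ 'n \<Rightarrow> real"
    and \<beta> :: "real \<Rightarrow> real"
  defines "C \<equiv> {c. 0 < c \<and> (\<exists>w :: real ^ 'n \<Rightarrow> real. global_min p c w)}"
  assumes p: "1 < p" "p < 3 + 4 / real CARD('n)"
    and minimizer: "\<And>c. c \<in> C \<Longrightarrow> global_min p c (v c)"
    and multiplier: "\<And>c. c \<in> C \<Longrightarrow> \<beta> c < 0 \<and> weak_solution p (\<beta> c) (v c)"
  shows "filterlim \<beta> at_bot (inf at_top (principal C))"
  unfolding filterlim_at_bot
proof
  fix B :: real
  \<comment> \<open>\<open>1 \<le> Z\<close> makes the minimal energy negative, as the integrability
    argument below requires; with \<open>- B \<le> Z\<close> it also gives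
    \<open>- (2 * Z) \<le> B\<close>.\<close>
  define Z where "Z = max 1 (- B)"
  have "0 < Z" by (simp add: Z_def)
  obtain c0 where "0 < c0"
    and low: "\<And>c. c0 < c \<Longrightarrow> \<exists>u :: real ^ 'n \<Rightarrow> real. u \<in> S c \<and> J p u \<le> - Z * c"
    using exists_low_energy[OF p(1) \<open>0 < Z\<close>, where 'a = "real ^ 'n"] by blast
  have "\<beta> c \<le> B" if "c0 < c" "c \<in> C" for c
  proof -
    have c: "0 < c" using that \<open>0 < c0\<close> by simp
    have v: "v c \<in> S c" and v_min: "ereal (J p (v c)) = m TYPE(real ^ 'n) p c"
      using minimizer[OF \<open>c \<in> C\<close>] by (auto simp: global_min_def)
    have min: "J p (v c) \<le> J p u" if "u \<in> S c" for u :: "real ^ 'n \<Rightarrow> real"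
    proof -
      have "m TYPE(real ^ 'n) p c \<le> ereal (J p u)"
        unfolding m_def using that by (rule INF_lower)
      then show ?thesis by (simp flip: v_min)
    qed
    obtain u :: "real ^ 'n \<Rightarrow> real" where "u \<in> S c" "J p u \<le> - Z * c"
      using low[OF \<open>c0 < c\<close>] by blast
    then have J: "J p (v c) \<le> - Z * c" using min[of u] by linarith
    have int: "integrable lebesgue (\<lambda>x. \<bar>v c x\<bar> powr (p + 1))"
    \<comment> \<open>A non-integrable power would count as \<open>0\<close> in \<open>J\<close>, making the energy nonnegative.\<close>
    proof (rule ccontr)
      assume "\<not> integrable lebesgue (\<lambda>x. \<bar>v c x\<bar> powr (p + 1))"
      then have "(LINT x|lebesgue. \<bar>v c x\<bar> powr (p + 1)) = 0"
        by (rule not_integrable_integral_eq)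
      then have "0 \<le> J p (v c)" by (simp add: J_def)
      moreover have "- Z * c < 0" using \<open>0 < Z\<close> c by simp
      ultimately show False using J by linarith
    qed
    have "\<beta> c * c \<le> 2 * J p (v c)"
      using multiplier[OF \<open>c \<in> C\<close>] by (intro minimizer_multiplier_le[OF p(1) c v _ int min]) auto
    also have "\<dots> \<le> (- (2 * Z)) * c" using J by simp
    finally have "\<beta> c \<le> - (2 * Z)" using c by (simp only: mult_le_cancel_right_pos)
    then show ?thesis by (simp add: Z_def)
  qed
  then show "\<forall>\<^sub>F c in inf at_top (principal C). \<beta> c \<le> B"
    unfolding eventually_inf_principal
    by (intro eventually_mono[OF eventually_gt_at_top[of c0]]) blast
qed

end
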